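(* Let $d\ge2$ and let $\mathcal L$ be a sibling $d$-invariant lamination. Let $C$ be a central strip of a leaf $\ell\in\mathcal L$ and its siblings (a full sibling collection whose common image is not a diameter) with long arc length $>\frac1{d+1}$. Let $\eta$ be the short arc length, and write $\ell_j=\sigma_d^j(\ell)$. Then the following hold. (1) The first image $\ell_1=\sigma_d(\ell)$ cannot reenter $C$. (2) The second image $\ell_2=\sigma_d^2(\ell)$ cannot reenter $C$ with both endpoints in a single component of $C\cap\mathbb S$. (3) If an iterate $\ell_j=\sigma_d^j(\ell)$ of $\ell$ reenters $C$, for least $j>1$, and has endpoints lying in one component of $C\cap\mathbb S$, then for some $k\le j-1$ the iterate $\ell_k$ gets at least as close in the endpoint metric as $\frac{\eta}{d^{\,j-k}}$ to a critical chord in $\overline{\mathbb D}\setminus C$; that is, there is a critical chord $D$ in $\overline{\mathbb D}\setminus C$ with $d_E(\ell_k,D)\le \frac{\eta}{d^{\,j-k}}$.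
   Context: Let $\mathbb D$ be the open unit disk in $\mathbb C$, $\overline{\mathbb D}$ its closure, and $\mathbb S$ the unit circle, parameterized as $\mathbb R/\mathbb Z$ with the counterclockwise circular order. For $d\ge2$, $\sigma_d:\mathbb S\to\mathbb S$ is $\sigma_d(t)=dt \pmod 1$. For $a,b\in\mathbb S$, $|(a,b)|$ is the length in $\mathbb R/\mathbb Z$ of the arc from $a$ counterclockwise to $b$. A lamination $\mathcal L$ is a collection of chords of $\overline{\mathbb D}$, called leaves, such that any two leaves meet, if at all, in a point of $\mathbb S$, and such that $\mathbb S\cup\bigcup\mathcal L$ is closed in $\overline{\mathbb D}$. All points of $\mathbb S$ are (degenerate) leaves. A chord with endpoints $a,b$ is written $\overline{ab}$; $\sigma_d(\overline{ab})=\overline{\sigma_d(a)\sigma_d(b)}$. A (non-degenerate) chord $\overline{ab}$ is critical if $\sigma_d(a)=\sigma_d(b)$; critical chords need not be leaves of $\mathcal L$. The length of $\overline{ab}$ is $\min\{|(a,b)|,|(b,a)|\}$. If $\sigma_d(\ell_1)=\ell'$ is a non-degenerate leaf, a leaf $\ell_2$ disjoint from $\ell_1$ with $\sigma_d(\ell_2)=\ell'$ is a sibling of $\ell_1$. A collection of $d$ pairwise disjoint leaves of $\mathcal L$, all mapped by $\sigma_d$ to the same non-degenerate leaf $\ell'$, is a full sibling collection. $\mathcal L$ is sibling $d$-invariant if: (i) $\sigma_d(\ell)\in\mathcal L$ for every $\ell\in\mathcal L$; (ii) every non-degenerate $\ell'\in\mathcal L$ is $\sigma_d(\ell)$ for some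 $\ell\in\mathcal L$; (iii) every $\ell_1\in\mathcal L$ with non-degenerate image belongs to a full sibling collection contained in $\mathcal L$. Only full sibling collections whose common image leaf is not a diameter are considered. The $2d$ endpoints of the leaves of such a collection divide $\mathbb S$ into $2d$ arcs which alternate between short arcs (length $<\frac1{2d}$, all of one common length, the short arc length) and long arcs (length $>\frac1{2d}$, all of one common length, the long arc length). The regions of the disk complementary to the $d$ leaves form the sibling portrait; a region is a $C$-region if all of the arcs in which its closure meets $\mathbb S$ are short; its degree is the number of leaves of the collection in its boundary. The central strip of the collection is the closure of the union of all $C$-regions of degree at least $2$. An iterate $\ell_j$ ($j\ge1$) reenters $C$ if it lies in $C$ (in particular both its endpoints are in $C\cap\mathbb S$). Endpoint metric: if $\overline{x_1y_1}$ and $\overline{x_2y_2}$ are chords meeting at most in one pair of endpoints, labeled so that in circular order $x_1<x_2<y_2\le y_1$, then $d_E(\overline{x_1y_1},\overline{x_2y_2})=|(x_1,x_2)|+|(y_2,y_1)|$; the distance from a chord to itself is $0$. It is defined only between non-crossing chords.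
   Formalization: In (3), when the reentering iterate ℓ_j is a single point, the critical chord D is only required to lie in the closure of the closed disk minus C (it may touch C at a corner), because the literal claim fails there, e.g. for d=3; for non-degenerate ℓ_j, D is disjoint from C as stated. *)

theory Defs
  imports "HOL-Analysis.Analysis"
begin

section \<open>The circle and its chords\<close>

text \<open>The circle \<open>\<real>/\<int>\<close> is realised as the unit circle in the complex plane, \<open>t\<close> being the
  parameter of \<open>cis (2 * pi * t)\<close>; the lemmas below express the maps in this parameter.\<close>

abbreviation circle :: "complex set" where
  "circle \<equiv> sphere 0 1"

definition circle_map :: "nat \<Rightarrow> complex \<Rightarrow> complex" where
  "circle_map d z = z ^ d"

lemma circle_map_cis: "circle_map d (cis (2 * pi * t)) = cis (2 * pi * (real d * t))"
  unfolding circle_map_def Complex.DeMoivre by (rule arg_cong[where f = cis]) simp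

text \<open>Length in \<open>\<real>/\<int>\<close> of the arc from \<open>a\<close> counterclockwise to \<open>b\<close>.\<close>

definition arc_len :: "complex \<Rightarrow> complex \<Rightarrow> real" where
  "arc_len a b = Arg2pi (b / a) / (2 * pi)"

lemma arc_len_cis: "arc_len (cis (2 * pi * s)) (cis (2 * pi * t)) = frac (t - s)"
proof -
  have "2 * pi * (t - s) = 2 * pi * frac (t - s) + of_int \<lfloor>t - s\<rfloor> * (2 * pi)"
    by (simp add: frac_def algebra_simps)
  then have "cis (2 * pi * (t - s)) = cis (2 * pi * frac (t - s))"
    by (metis cis_mult cis_multiple_2pi Ints_of_int mult.commute mult.right_neutral)
  then have "cis (2 * pi * t) / cis (2 * pi * s) = cis (2 * pi * frac (t - s))"
    by (simp add: cis_divide algebra_simps)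
  moreover have "Arg2pi (cis (2 * pi * frac (t - s))) = 2 * pi * frac (t - s)"
    by (rule Arg2pi_unique[of 1]) (auto simp: cis_conv_exp mult_ac frac_lt_1)
  ultimately show ?thesis
    by (simp add: arc_len_def)
qed

definition ccw_arc :: "complex \<Rightarrow> complex \<Rightarrow> complex set" where
  "ccw_arc a b = {z \<in> circle. arc_len a z \<le> arc_len a b}"

text \<open>Degenerate chords, i.e. points of the circle, are included.\<close>

definition is_chord :: "complex set \<Rightarrow> bool" where
  "is_chord l \<longleftrightarrow> (\<exists>a\<in>circle. \<exists>b\<in>circle. l = closed_segment a b)"

definition degenerate :: "complex set \<Rightarrow> bool" where
  "degenerate l \<longleftrightarrow> (\<exists>a. l = {a})"

definition is_diameter :: "complex set \<Rightarrow> bool" where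
  "is_diameter l \<longleftrightarrow> (\<exists>a\<in>circle. l = closed_segment a (- a))"

definition critical_chord :: "nat \<Rightarrow> complex set \<Rightarrow> bool" where
  "critical_chord d l \<longleftrightarrow>
     (\<exists>a\<in>circle. \<exists>b\<in>circle. a \<noteq> b \<and> circle_map d a = circle_map d b \<and> l = closed_segment a b)"

definition chord_ends :: "complex set \<Rightarrow> complex set" where
  "chord_ends l = l \<inter> circle"

definition chord_image :: "nat \<Rightarrow> complex set \<Rightarrow> complex set" where
  "chord_image d l = convex hull (circle_map d ` chord_ends l)"

lemma chord_ends_closed_segment:
  assumes "a \<in> circle" "b \<in> circle"
  shows "chord_ends (closed_segment a b) = {a, b}"
proof -
  have "z \<notin> circle" if "z \<in> open_segment a b" for z
    using that assms dist_decreases_open_segment[of z a b 0] by (auto simp: dist_commute)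
  then show ?thesis
    using assms unfolding chord_ends_def closed_segment_eq_open by auto
qed

lemma chord_image_closed_segment:
  assumes "a \<in> circle" "b \<in> circle"
  shows "chord_image d (closed_segment a b) = closed_segment (circle_map d a) (circle_map d b)"
  unfolding chord_image_def chord_ends_closed_segment[OF assms] by (simp add: segment_convex_hull)

text \<open>\<open>has_endpoint_dist l m r\<close>: the endpoint metric is defined at \<open>l\<close> and \<open>m\<close>, with value \<open>r\<close>.
  The circular order \<open>x1 < x2 < y2 \<le> y1\<close> is the order in which the points are met going
  counterclockwise from \<open>x1\<close>. Either chord may be the one labelled 1: when the chords are disjoint
  both choices give the same value, when they share an endpoint exactly one choice is possible.\<close>

definition ordered_endpoint_dist :: "complex set \<Rightarrow> complex set \<Rightarrow> real \<Rightarrow> bool" where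
  "ordered_endpoint_dist l1 l2 r \<longleftrightarrow>
     (\<exists>x1\<in>circle. \<exists>y1\<in>circle. \<exists>x2\<in>circle. \<exists>y2\<in>circle.
        l1 = closed_segment x1 y1 \<and> l2 = closed_segment x2 y2 \<and>
        0 < arc_len x1 x2 \<and> arc_len x1 x2 < arc_len x1 y2 \<and> arc_len x1 y2 \<le> arc_len x1 y1 \<and>
        r = arc_len x1 x2 + arc_len y2 y1)"

definition has_endpoint_dist :: "complex set \<Rightarrow> complex set \<Rightarrow> real \<Rightarrow> bool" where
  "has_endpoint_dist l m r \<longleftrightarrow>
     is_chord l \<and> is_chord m \<and>
     (if l = m then r = 0 else ordered_endpoint_dist l m r \<or> ordered_endpoint_dist m l r)"

section \<open>Sibling invariant laminations\<close>

definition lamination :: "complex set set \<Rightarrow> bool" where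
  "lamination L \<longleftrightarrow>
     (\<forall>l\<in>L. is_chord l) \<and>
     (\<forall>z\<in>circle. {z} \<in> L) \<and>
     (\<forall>l\<in>L. \<forall>m\<in>L. l \<noteq> m \<longrightarrow> l \<inter> m = {} \<or> (\<exists>z\<in>circle. l \<inter> m = {z})) \<and>
     closed (circle \<union> \<Union>L)"

definition full_sibling_collection :: "nat \<Rightarrow> complex set set \<Rightarrow> complex set set \<Rightarrow> bool" where
  "full_sibling_collection d L F \<longleftrightarrow>
     F \<subseteq> L \<and> finite F \<and> card F = d \<and> pairwise disjnt F \<and>
     (\<exists>l'\<in>L. \<not> degenerate l' \<and> (\<forall>l\<in>F. chord_image d l = l'))"

definition sibling_invariant_lamination :: "nat \<Rightarrow> complex set set \<Rightarrow> bool" where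
  "sibling_invariant_lamination d L \<longleftrightarrow>
     lamination L \<and>
     (\<forall>l\<in>L. chord_image d l \<in> L) \<and>
     (\<forall>l'\<in>L. \<not> degenerate l' \<longrightarrow> (\<exists>l\<in>L. chord_image d l = l')) \<and>
     (\<forall>l\<in>L. \<not> degenerate (chord_image d l) \<longrightarrow> (\<exists>F. full_sibling_collection d L F \<and> l \<in> F))"

section \<open>Sibling portraits and central strips\<close>

text \<open>A complementary arc of the set of endpoints is represented by the pair \<open>(a, b)\<close> of its
  endpoints, the arc being \<open>ccw_arc a b\<close>.\<close>

definition sibling_arcs :: "complex set set \<Rightarrow> (complex \<times> complex) set" where
  "sibling_arcs F = (let E = \<Union> (chord_ends ` F) in
     {(a, b). a \<in> E \<and> b \<in> E \<and> a \<noteq> b \<and> \<not> (\<exists>e\<in>E. 0 < arc_len a e \<and> arc_len a e < arc_len a b)})"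

definition short_arcs :: "nat \<Rightarrow> complex set set \<Rightarrow> (complex \<times> complex) set" where
  "short_arcs d F = {(a, b) \<in> sibling_arcs F. arc_len a b < 1 / (2 * real d)}"

definition long_arcs :: "nat \<Rightarrow> complex set set \<Rightarrow> (complex \<times> complex) set" where
  "long_arcs d F = {(a, b) \<in> sibling_arcs F. arc_len a b > 1 / (2 * real d)}"

text \<open>The common length of the short (long) arcs; it exists for a full sibling collection whose
  common image is not a diameter.\<close>

definition short_arc_length :: "nat \<Rightarrow> complex set set \<Rightarrow> real" where
  "short_arc_length d F = (THE r. (\<lambda>(a, b). arc_len a b) ` short_arcs d F = {r})"

definition long_arc_length :: "nat \<Rightarrow> complex set set \<Rightarrow> real" where
  "long_arc_length d F = (THE r. (\<lambda>(a, b). arc_len a b) ` long_arcs d F = {r})"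

definition portrait_regions :: "complex set set \<Rightarrow> complex set set" where
  "portrait_regions F = components (ball 0 1 - \<Union>F)"

definition C_region :: "nat \<Rightarrow> complex set set \<Rightarrow> complex set \<Rightarrow> bool" where
  "C_region d F R \<longleftrightarrow>
     R \<in> portrait_regions F \<and>
     (\<forall>A \<in> components (closure R \<inter> circle). \<exists>(a, b) \<in> short_arcs d F. A = ccw_arc a b)"

definition region_degree :: "complex set set \<Rightarrow> complex set \<Rightarrow> nat" where
  "region_degree F R = card {l \<in> F. l \<subseteq> frontier R}"

definition central_strip :: "nat \<Rightarrow> complex set set \<Rightarrow> complex set" where
  "central_strip d F = closure (\<Union> {R. C_region d F R \<and> 2 \<le> region_degree F R})"

definition reenters :: "complex set \<Rightarrow> complex set \<Rightarrow> bool" where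
  "reenters C l \<longleftrightarrow> l \<subseteq> C"

definition ends_in_one_component :: "complex set \<Rightarrow> complex set \<Rightarrow> bool" where
  "ends_in_one_component C l \<longleftrightarrow> (\<exists>A \<in> components (C \<inter> circle). chord_ends l \<subseteq> A)"

text \<open>A pitfall: an iterate that reenters \<open>C\<close> may be a single point. Then some earlier iterate is a
  critical chord. It is not contained in \<open>C\<close>, but it can end at a corner of \<open>C\<close>, in which case
  it lies only in the closure of the complement of \<open>C\<close>, and there need not be a
  critical chord disjoint from \<open>C\<close> near the orbit. Example with \<open>d = 3\<close>, in units of \<open>1/216\<close>:
  the siblings \<open>(27,155)\<close>, \<open>(83,99)\<close>, \<open>(171,11)\<close> have the iterates \<open>(33,81)\<close>, \<open>(27,99)\<close>,
  \<open>81\<close>, \<open>27\<close>, and \<open>27\<close> is a corner of \<open>C\<close>.\<close>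

end

theory Submission
  imports Defs "HOL-Computational_Algebra.Polynomial"
begin

text \<open>Everything about the siblings is read off from the position of \<open>\<sigma>\<^sub>d(t)\<close> relative to the
  image leaf \<open>\<ell>\<^sub>1\<close>, whose endpoints are at distance \<open>h = d \<eta> < 1 / (d + 1)\<close>: a point lies in a short
  arc iff its image lies in the arc of length \<open>h\<close>, and on the circle the product of the affine functions
  defining the \<open>d\<close> leaves is the affine function of \<open>\<ell>\<^sub>1\<close> composed with \<open>\<sigma>\<^sub>d\<close>. The regions of the portrait are the
  sign cells of these functions, so the sign of the product shows that a region meets either only short arcs
  or only long arcs. Parts (1) and (2) compare \<open>h\<close> and \<open>d h\<close> with the arc lengths. For (3), the
  endpoint difference of \<open>\<ell>\<^sub>j\<close> is within \<open>\<eta>\<close> of an integer and that of \<open>\<ell>\<^sub>1\<close> is not, so for some \<open>k\<close> the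
  endpoint difference of \<open>\<ell>\<^sub>k\<close> is within \<open>\<eta> / d^(j - k)\<close> of a non-integral multiple of \<open>1 / d\<close>; moving one
  endpoint makes it critical. Since \<open>\<ell>\<^sub>k\<close> crosses no sibling and does not lie in \<open>C\<close>, its endpoints are not
  inside short arcs, and the endpoint that stays fixed can be chosen inside a long arc.\<close>

section \<open>The circle and affine functions of chords\<close>

definition circ :: "real \<Rightarrow> complex" where
  "circ t = cis (2 * pi * t)"

lemma norm_circ [simp]: "norm (circ t) = 1"
  by (simp add: circ_def)

lemma circ_mem: "circ t \<in> circle"
  by simp

lemma circ_nonzero [simp]: "circ t \<noteq> 0"
  by (simp add: circ_def)

lemma circ_add: "circ (s + t) = circ s * circ t"
  by (simp add: circ_def cis_mult ring_distribs)

lemma circ_power: "circ t ^ n = circ (real n * t)"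
  unfolding circ_def Complex.DeMoivre by (simp add: mult_ac)

lemma circle_map_circ: "circle_map n (circ t) = circ (real n * t)"
  by (simp add: circle_map_def circ_power)

lemma circle_imp_circ: "z \<in> circle \<Longrightarrow> \<exists>t. z = circ t"
proof -
  assume "z \<in> circle"
  then have "z = cis (Arg z)"
    using cis_Arg[of z] by (cases "z = 0") (auto simp: sgn_eq)
  then have "z = circ (Arg z / (2 * pi))"
    by (simp add: circ_def)
  then show ?thesis ..
qed

lemma arc_len_circ: "arc_len (circ s) (circ t) = frac (t - s)"
  unfolding circ_def by (rule arc_len_cis)

lemma circ_eq_iff: "circ s = circ t \<longleftrightarrow> s - t \<in> \<int>"
proof
  assume "circ s = circ t"
  then have "arc_len (circ t) (circ s) = arc_len (circ t) (circ t)"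
    by simp
  then show "s - t \<in> \<int>"
    by (simp add: arc_len_circ)
next
  assume "s - t \<in> \<int>"
  then obtain n where "s = t + of_int n"
    by (metis Ints_cases add.commute diff_add_cancel)
  moreover have "circ (of_int n) = 1"
    unfolding circ_def by (rule cis_multiple_2pi) simp
  ultimately show "circ s = circ t"
    by (simp add: circ_add)
qed

lemma continuous_on_circ [continuous_intros]: "continuous_on S g \<Longrightarrow> continuous_on S (\<lambda>x. circ (g x))"
  unfolding circ_def by (intro continuous_intros)

lemma ccw_arc_circ:
  assumes "0 \<le> r" "r < 1"
  shows "ccw_arc (circ s) (circ (s + r)) = circ ` {s..s + r}"
proof -
  have "z \<in> circ ` {s..s + r}" if z: "z \<in> circle" "arc_len (circ s) z \<le> r" for z
  proof -
    obtain t where t: "z = circ t" using circle_imp_circ z(1) by blast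
    have "z = circ (s + frac (t - s))"
      unfolding t circ_eq_iff by (simp add: frac_def)
    moreover have "frac (t - s) \<le> r" using z(2) by (simp add: t arc_len_circ)
    ultimately show ?thesis by (intro image_eqI[of _ _ "s + frac (t - s)"]) auto
  qed
  moreover have "frac (t - s) \<le> r" if "t \<in> {s..s + r}" for t
  proof -
    have "frac (t - s) = t - s" using that assms by (subst frac_eq) auto
    then show ?thesis using that by simp
  qed
  moreover have "frac r = r" using assms by (subst frac_eq) auto
  ultimately show ?thesis
    unfolding ccw_arc_def by (auto simp: arc_len_circ)
qed

text \<open>For \<open>w\<^sup>2 = p q\<close>, the line through \<open>p\<close> and \<open>q\<close> is orthogonal to \<open>w\<close>, and \<open>side w p q\<close> is an
  affine function vanishing on it, normalised so that on the circle it factors as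
  \<open>(z - p) (z - q) / (z w)\<close>.\<close>

definition side :: "complex \<Rightarrow> complex \<Rightarrow> complex \<Rightarrow> complex \<Rightarrow> real" where
  "side w p q z = 2 * Re (z * cnj w) - Re ((p + q) * cnj w)"

lemma side_affine: "side w p q ((1 - u) *\<^sub>R x + u *\<^sub>R y) = (1 - u) * side w p q x + u * side w p q y"
  by (simp add: side_def algebra_simps)

lemma continuous_on_side [continuous_intros]:
  "continuous_on S g \<Longrightarrow> continuous_on S (\<lambda>x. side w p q (g x))"
  unfolding side_def by (intro continuous_intros)

section \<open>Zeros and values of the affine function of a chord\<close>

lemma norm_sqrt_mult:
  fixes w :: complex
  assumes "p \<in> circle" "q \<in> circle" "w\<^sup>2 = p * q"
  shows "norm w = 1"
proof -
  have "norm w ^ 2 = 1" using assms by (simp flip: norm_power add: norm_mult)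
  then show ?thesis by (simp add: power2_eq_1_iff) (metis norm_ge_zero not_one_le_zero neg_0_le_iff_le)
qed

lemma mult_cnj_unit: "norm z = 1 \<Longrightarrow> z * cnj z = 1"
  by (simp add: complex_norm_square[symmetric])

text \<open>Multiplication by \<open>cnj w\<close> is a rotation that makes the chord vertical, so
  its two ends become complex conjugates.\<close>

lemma sqrt_mult_cnj:
  assumes "p \<in> circle" "q \<in> circle" "w\<^sup>2 = p * q"
  shows "q * cnj w = cnj (p * cnj w)"
proof -
  have w: "w * cnj w = 1" and p: "p * cnj p = 1"
    using assms norm_sqrt_mult[OF assms] by (auto intro: mult_cnj_unit)
  have "q * cnj w = (p * cnj p) * q * cnj w" by (simp add: p)
  also have "\<dots> = cnj p * (w\<^sup>2) * cnj w" unfolding assms(3) by (simp add: mult_ac)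
  also have "\<dots> = cnj p * w * (w * cnj w)" by (simp add: power2_eq_square mult_ac)
  finally show ?thesis by (simp add: w)
qed

text \<open>On the circle \<open>cnj z\<close> is the inverse of \<open>z\<close>, so twice the real
  part of \<open>z * cnj w\<close> is \<open>z / w + w / z\<close>. Clearing denominators leaves a
  quadratic in \<open>z\<close> with roots \<open>p\<close> and \<open>q\<close>.\<close>

lemma side_circle:
  assumes pq: "p \<in> circle" "q \<in> circle" "w\<^sup>2 = p * q" and z: "z \<in> circle"
  shows "of_real (side w p q z) * (z * w) = (z - p) * (z - q)"
proof -
  have w: "w * cnj w = 1" and z: "z * cnj z = 1"
    using z norm_sqrt_mult[OF pq] by (auto intro: mult_cnj_unit)
  have "of_real (side w p q z) = z * cnj w + cnj (z * cnj w) - (p + q) * cnj w"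
  proof -
    have "of_real (2 * Re (z * cnj w)) = z * cnj w + cnj (z * cnj w)"
      by (rule complex_add_cnj[symmetric])
    moreover have "of_real (Re ((p + q) * cnj w)) = (p + q) * cnj w"
      using sqrt_mult_cnj[OF pq] by (simp add: ring_distribs complex_eq_iff)
    ultimately show ?thesis by (simp only: side_def of_real_diff)
  qed
  then have "of_real (side w p q z) * (z * w) = (z * cnj w + cnj z * w - (p + q) * cnj w) * (z * w)"
    by simp
  also have "\<dots> = z * z * (w * cnj w) + (z * cnj z) * w\<^sup>2 - (p + q) * z * (w * cnj w)"
    by (simp add: algebra_simps power2_eq_square)
  finally show ?thesis
    by (simp add: w z pq(3)) (simp add: algebra_simps)
qed

lemma side_circle_eq_0_iff:
  assumes "p \<in> circle" "q \<in> circle" "w\<^sup>2 = p * q" "z \<in> circle"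
  shows "side w p q z = 0 \<longleftrightarrow> z = p \<or> z = q"
proof -
  have "z * w \<noteq> 0" using assms norm_sqrt_mult[OF assms(1-3)] by auto
  then show ?thesis
    using side_circle[OF assms] by (metis eq_iff_diff_eq_0 mult_eq_0_iff of_real_eq_0_iff)
qed

text \<open>After the rotation by \<open>cnj w\<close>, a zero \<open>Z\<close> has the same real
  part as the end \<open>P\<close>. The bound on the norm then forces the imaginary part of
  \<open>Z\<close> between those of \<open>P\<close> and \<open>cnj P\<close>.\<close>

lemma side_eq_0_iff:
  assumes pq: "p \<in> circle" "q \<in> circle" "w\<^sup>2 = p * q" "p \<noteq> q" and z: "norm z \<le> 1"
  shows "side w p q z = 0 \<longleftrightarrow> z \<in> closed_segment p q"
proof
  assume "z \<in> closed_segment p q"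
  then show "side w p q z = 0"
    using side_circle_eq_0_iff[OF pq(1-3) pq(1)] side_circle_eq_0_iff[OF pq(1-3) pq(2)]
    by (auto simp: closed_segment_def side_affine)
next
  assume 0: "side w p q z = 0"
  define P Z where "P = p * cnj w" and "Z = z * cnj w"
  have w: "cnj w * w = 1" and nw: "norm w = 1"
    using norm_sqrt_mult[OF pq(1-3)] mult_cnj_unit[of w] by (auto simp: mult.commute)
  have q: "q * cnj w = cnj P" using sqrt_mult_cnj[OF pq(1-3)] by (simp add: P_def)
  have rot: "x = (x * cnj w) * w" for x using w by (simp add: mult.assoc)
  have "norm P = 1" "norm Z \<le> 1" using pq z nw by (auto simp: P_def Z_def norm_mult)
  then have nP: "(Re P)\<^sup>2 + (Im P)\<^sup>2 = 1" and nZ: "(Re Z)\<^sup>2 + (Im Z)\<^sup>2 \<le> 1"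
    by (simp_all add: cmod_def)
  have "Re ((p + q) * cnj w) = 2 * Re P"
    using q by (simp add: ring_distribs P_def)
  then have re: "Re Z = Re P" using 0 by (simp add: side_def Z_def)
  have "Im P \<noteq> 0"
  proof
    assume "Im P = 0"
    then have "cnj P = P" by (simp add: complex_eq_iff)
    then have "q * cnj w = p * cnj w" using q P_def by simp
    then show False using pq(4) w by auto
  qed
  have "\<bar>Im Z\<bar> \<le> \<bar>Im P\<bar>" using nP nZ re by (simp add: abs_le_square_iff)
  \<comment> \<open>Solution of \<open>Im Z = (1 - 2 * u) * Im P\<close>, the imaginary part of the
    required convex combination.\<close>
  define u where "u = (1 - Im Z / Im P) / 2"
  have "\<bar>Im Z / Im P\<bar> \<le> 1" using \<open>\<bar>Im Z\<bar> \<le> \<bar>Im P\<bar>\<close> \<open>Im P \<noteq> 0\<close> by (simp add: abs_divide)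
  then have "Im Z / Im P \<le> 1" "- 1 \<le> Im Z / Im P" by linarith+
  then have u: "0 \<le> u" "u \<le> 1" by (simp_all add: u_def)
  have "Z = (1 - u) *\<^sub>R P + u *\<^sub>R cnj P"
    using \<open>Im P \<noteq> 0\<close> re by (simp add: complex_eq_iff u_def field_simps)
  then have "Z * w = (1 - u) *\<^sub>R (P * w) + u *\<^sub>R (cnj P * w)"
    by (simp only: distrib_right mult_scaleR_left)
  then have "z = (1 - u) *\<^sub>R p + u *\<^sub>R q"
    unfolding Z_def P_def q[unfolded P_def, symmetric] rot[symmetric] .
  then show "z \<in> closed_segment p q" using u by (auto simp: closed_segment_def)
qed

text \<open>The midpoint \<open>circ (s + h / 2)\<close> of the arc is one of the two square roots,
  and \<open>\<kappa>\<close> records which one \<open>w\<close> is. Seen from it both ends have the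
  same cosine, and a difference of cosines factors into sines.\<close>

lemma side_circ:
  assumes "w\<^sup>2 = circ s * circ (s + h)"
  shows "\<exists>\<kappa>\<in>{1, -1}. \<forall>t. side w (circ s) (circ (s + h)) (circ t) = \<kappa> * (4 * sin (pi * (t - s)) * sin (pi * (h - (t - s))))"
proof -
  have "w\<^sup>2 = (circ (s + h / 2))\<^sup>2"
    unfolding assms circ_power by (simp add: circ_add[symmetric] ring_distribs)
  then obtain \<kappa> :: real where \<kappa>: "\<kappa> \<in> {1, -1}" "w = of_real \<kappa> * circ (s + h / 2)"
    by (auto simp: power2_eq_iff intro: that[of 1] that[of "-1"])
  have c: "Re (circ a * cnj (circ b)) = cos (2 * pi * (a - b))" for a b
    by (simp add: circ_def cos_diff ring_distribs mult_ac)
  have "side w (circ s) (circ (s + h)) (circ t) = \<kappa> * (4 * sin (pi * (t - s)) * sin (pi * (h - (t - s))))" for t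
  proof -
    have "side w (circ s) (circ (s + h)) (circ t)
        = \<kappa> * (2 * cos (2 * pi * (t - (s + h / 2))) - (cos (2 * pi * (s - (s + h / 2))) + cos (2 * pi * ((s + h) - (s + h / 2)))))"
      unfolding side_def c[symmetric] \<kappa>(2) by (simp add: algebra_simps)
    also have "cos (2 * pi * (s - (s + h / 2))) = cos (pi * h)"
      by (simp add: field_simps)
    also have "cos (2 * pi * ((s + h) - (s + h / 2))) = cos (pi * h)"
      by (simp add: field_simps)
    also have "2 * cos (2 * pi * (t - (s + h / 2))) - (cos (pi * h) + cos (pi * h)) = 2 * (cos (2 * pi * (t - (s + h / 2))) - cos (pi * h))"
      by simp
    also have "\<dots> = 4 * sin (pi * (t - s)) * sin (pi * (h - (t - s)))"
    proof -
      have "(2 * pi * (t - (s + h / 2)) + pi * h) / 2 = pi * (t - s)"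
        "(pi * h - 2 * pi * (t - (s + h / 2))) / 2 = pi * (h - (t - s))"
        by (simp_all add: field_simps)
      then show ?thesis unfolding cos_diff_cos by simp
    qed
    finally show ?thesis .
  qed
  with \<kappa>(1) show ?thesis by blast
qed

text \<open>Both sides are monic polynomials of degree \<open>n\<close> that agree at the
  \<open>n\<close> roots.\<close>

lemma nth_root_factorization:
  fixes c z :: complex
  assumes "c \<noteq> 0" "n > 0"
  shows "(\<Prod>x | x ^ n = c. z - x) = z ^ n - c"
proof -
  let ?R = "{x. x ^ n = c}" and ?q = "monom 1 n + [:- c:]"
  have R: "finite ?R" "card ?R = n"
    using assms by (simp_all add: finite_nth_roots card_nth_roots)
  have deg: "degree (\<Prod>x\<in>S. [:- x, 1:]) = card S" for S :: "complex set"
    by (subst degree_prod_sum_eq) auto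
  have monic: "lead_coeff (\<Prod>x\<in>S. [:- x, 1:]) = 1" if "finite S" for S :: "complex set"
    using that by (induction S) (simp_all add: lead_coeff_mult del: mult_pCons_left mult_pCons_right)
  have degq: "degree ?q = degree (monom (1::complex) n)"
    using assms by (intro degree_add_eq_left) (simp add: degree_monom_eq)
  have "(\<Prod>x\<in>?R. [:- x, 1:]) = ?q"
  proof (rule poly_eqI_degree_lead_coeff[where n = n and A = ?R])
    show "coeff (\<Prod>x\<in>?R. [:- x, 1:]) n = coeff ?q n"
      using monic[OF R(1)] assms by (simp add: deg R coeff_pCons split: nat.split)
    show "poly (\<Prod>x\<in>?R. [:- x, 1:]) y = poly ?q y" if "y \<in> ?R" for y
      using that R(1) by (auto simp: poly_prod poly_monom)
  qed (simp_all add: deg R degq degree_monom_eq)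
  then have "poly (\<Prod>x\<in>?R. [:- x, 1:]) z = poly ?q z"
    by simp
  then show ?thesis
    by (simp add: poly_prod poly_monom)
qed

section \<open>Full sibling collections\<close>

lemma Ints_abs_less_1: "x \<in> \<int> \<Longrightarrow> - 1 < x \<Longrightarrow> x < 1 \<Longrightarrow> x = (0 :: real)"
  by (auto elim!: Ints_cases)

lemma Ints_not_between: "x \<in> \<int> \<Longrightarrow> 0 < x \<Longrightarrow> x < 1 \<Longrightarrow> False" for x :: real
  by (auto elim!: Ints_cases)

lemma circle_eq_circ_add:
  assumes "z \<in> circle"
  shows "z = circ (s + arc_len (circ s) z)"
proof -
  obtain t where t: "z = circ t" using circle_imp_circ assms by blast
  show ?thesis by (simp add: t arc_len_circ circ_eq_iff frac_def)
qed

text \<open>Common to both kinds of arcs: it is applied with the gap \<open>h\<close> after a corner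
  that starts a short arc and with the gap \<open>1 - h\<close> after one that starts a long arc.
  The smallest positive offset of a corner is the gap divided by \<open>d\<close>.\<close>

lemma next_corner:
  assumes E: "\<And>t. circ t \<in> E \<longleftrightarrow> real d * (t - s) \<in> \<int> \<or> real d * (t - s) - h \<in> \<int>"
    and "E \<subseteq> circle" and h: "0 < h" "h < 1" and d: "d > 0"
  shows "circ s \<in> E \<and> b \<in> E \<and> circ s \<noteq> b \<and>
      \<not> (\<exists>e\<in>E. 0 < arc_len (circ s) e \<and> arc_len (circ s) e < arc_len (circ s) b)
    \<longleftrightarrow> b = circ (s + h / real d)"
proof -
  have hd: "0 < h / real d" "h / real d < 1"
    using h d by (auto simp: field_simps)
  then have frac_hd: "frac (h / real d) = h / real d"
    by (simp add: frac_eq)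
  have E': "real d * r \<ge> h" if "circ (s + r) \<in> E" "0 < r" for r
  proof (rule ccontr)
    assume "\<not> ?thesis"
    then have "real d * r < h" "0 < real d * r" using that d by auto
    then show False
      using E[of "s + r"] that(1) h Ints_not_between[of "real d * r"] Ints_abs_less_1[of "real d * r - h"]
      by auto
  qed
  show ?thesis
  proof
    assume b: "circ s \<in> E \<and> b \<in> E \<and> circ s \<noteq> b \<and>
      \<not> (\<exists>e\<in>E. 0 < arc_len (circ s) e \<and> arc_len (circ s) e < arc_len (circ s) b)"
    define r where "r = arc_len (circ s) b"
    have br: "b = circ (s + r)"
      unfolding r_def using b assms(2) by (intro circle_eq_circ_add) auto
    obtain t where "b = circ t" using b assms(2) circle_imp_circ by blast
    then have "0 \<le> r" by (simp add: r_def arc_len_circ)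
    moreover have "r \<noteq> 0" using b br by auto
    ultimately have "0 < r" by simp
    have "circ (s + h / real d) \<in> E" using d by (simp add: E)
    then have "\<not> h / real d < r"
      using b hd by (auto simp: r_def arc_len_circ frac_hd)
    moreover have "h \<le> real d * r"
      using E' b br \<open>0 < r\<close> by blast
    ultimately have "r = h / real d"
      using d by (auto simp: field_simps)
    then show "b = circ (s + h / real d)" using br by simp
  next
    assume b: "b = circ (s + h / real d)"
    have "h / real d \<notin> \<int>" using hd Ints_not_between by blast
    moreover have "\<not> (0 < arc_len (circ s) e \<and> arc_len (circ s) e < h / real d)" if "e \<in> E" for e
    proof
      assume r: "0 < arc_len (circ s) e \<and> arc_len (circ s) e < h / real d"
      have "e = circ (s + arc_len (circ s) e)"
        using that assms(2) by (intro circle_eq_circ_add) auto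
      then show False using E' r that d by (metis mult.commute not_le pos_less_divide_eq of_nat_0_less_iff)
    qed
    ultimately show "circ s \<in> E \<and> b \<in> E \<and> circ s \<noteq> b \<and>
      \<not> (\<exists>e\<in>E. 0 < arc_len (circ s) e \<and> arc_len (circ s) e < arc_len (circ s) b)"
      using d by (auto simp: b E circ_eq_iff arc_len_circ frac_hd)
  qed
qed

text \<open>The image leaf is oriented so that its shorter arc, of length \<open>h\<close>, runs
  counterclockwise from \<open>circ (real d * \<alpha>)\<close>. For a leaf \<open>f\<close>, the
  ends \<open>p f\<close> and \<open>q f\<close> lie over the start and the end of that arc. They
  need not bound the same short arc.\<close>

locale sibling_collection =
  fixes d :: nat and F :: "complex set set" and p q :: "complex set \<Rightarrow> complex" and \<alpha> h :: real
  assumes d2: "d \<ge> 2" and finite_F: "finite F" and card_F: "card F = d"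
    and disjoint_F: "pairwise disjnt F"
    and h: "0 < h" "h < 1 / 2"
    and leaf: "\<And>f. f \<in> F \<Longrightarrow> f = closed_segment (p f) (q f)"
    and p_circle: "\<And>f. f \<in> F \<Longrightarrow> p f \<in> circle" and q_circle: "\<And>f. f \<in> F \<Longrightarrow> q f \<in> circle"
    and p_power: "\<And>f. f \<in> F \<Longrightarrow> p f ^ d = circ (real d * \<alpha>)"
    and q_power: "\<And>f. f \<in> F \<Longrightarrow> q f ^ d = circ (real d * \<alpha> + h)"
begin

definition corners :: "complex set" where
  "corners = \<Union> (chord_ends ` F)"

text \<open>The position of \<open>\<sigma>\<^sub>d(t)\<close> relative to the image leaf: short arcs are where it is at
  most \<open>h\<close>, and the endpoints of the leaves are where it is \<open>0\<close> or \<open>h\<close>.\<close>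

definition pos :: "real \<Rightarrow> real" where
  "pos t = frac (real d * (t - \<alpha>))"

lemma d_pos: "0 < real d" using d2 by simp

lemma chord_ends_leaf: "f \<in> F \<Longrightarrow> chord_ends f = {p f, q f}"
  using chord_ends_closed_segment[OF p_circle q_circle] leaf by metis

lemma leaf_ends: "f \<in> F \<Longrightarrow> p f \<in> f" "f \<in> F \<Longrightarrow> q f \<in> f"
  using leaf by (metis ends_in_segment)+

lemma same_leaf: "f \<in> F \<Longrightarrow> g \<in> F \<Longrightarrow> z \<in> f \<Longrightarrow> z \<in> g \<Longrightarrow> f = g"
  using disjoint_F by (auto simp: pairwise_def disjnt_def)

text \<open>Disjoint leaves have different ends, so the \<open>d\<close> leaves use up all
  \<open>d\<close> preimages of the start of the image arc.\<close>

lemma image_p: "p ` F = {z. z ^ d = circ (real d * \<alpha>)}"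
  and inj_p: "inj_on p F"
proof -
  show inj: "inj_on p F"
    using leaf_ends(1) same_leaf by (metis inj_onI)
  show "p ` F = {z. z ^ d = circ (real d * \<alpha>)}"
    using d2 p_power card_image[OF inj] card_F
    by (intro card_subset_eq) (auto simp: card_nth_roots finite_nth_roots)
qed

lemma image_q: "q ` F = {z. z ^ d = circ (real d * \<alpha> + h)}"
  and inj_q: "inj_on q F"
proof -
  show inj: "inj_on q F"
    using leaf_ends(2) same_leaf by (metis inj_onI)
  show "q ` F = {z. z ^ d = circ (real d * \<alpha> + h)}"
    using d2 q_power card_image[OF inj] card_F
    by (intro card_subset_eq) (auto simp: card_nth_roots finite_nth_roots)
qed

lemma pos_bounds: "0 \<le> pos t" "pos t < 1"
  by (simp_all add: pos_def frac_lt_1)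

lemma pos_eq_iff: "0 \<le> r \<Longrightarrow> r < 1 \<Longrightarrow> pos t = r \<longleftrightarrow> real d * (t - \<alpha>) - r \<in> \<int>"
  by (simp add: pos_def frac_unique_iff)

lemma pos_add: "real d * r \<in> \<int> \<Longrightarrow> pos (t + r) = pos t"
  by (simp add: pos_def ring_distribs diff_add_eq[symmetric] frac_add_int_right)

lemma pos_shift: "0 \<le> pos t + real d * r \<Longrightarrow> pos t + real d * r < 1 \<Longrightarrow> pos (t + r) = pos t + real d * r"
  using pos_eq_iff[OF pos_bounds, of t t] by (subst pos_eq_iff) (simp_all add: algebra_simps)

lemma circ_power_eq_iff: "0 \<le> r \<Longrightarrow> r < 1 \<Longrightarrow> circ t ^ d = circ (real d * \<alpha> + r) \<longleftrightarrow> pos t = r"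
  by (simp add: circ_power circ_eq_iff pos_eq_iff algebra_simps)

lemma circ_corner_iff: "circ t \<in> corners \<longleftrightarrow> pos t = 0 \<or> pos t = h"
proof -
  have "corners = p ` F \<union> q ` F"
    unfolding corners_def using chord_ends_leaf by auto
  then show ?thesis
    using circ_power_eq_iff[of 0 t] circ_power_eq_iff[of h t] h by (simp add: image_p image_q)
qed

lemma corners_circle: "corners \<subseteq> circle"
  using chord_ends_leaf p_circle q_circle by (auto simp: corners_def)

section \<open>Short and long arcs and their common lengths\<close>

lemma sibling_arcs_short:
  assumes "pos s = 0"
  shows "(circ s, b) \<in> sibling_arcs F \<longleftrightarrow> b = circ (s + h / real d)"
proof -
  have "circ s \<in> corners \<and> b \<in> corners \<and> circ s \<noteq> b \<and>
      \<not> (\<exists>e\<in>corners. 0 < arc_len (circ s) e \<and> arc_len (circ s) e < arc_len (circ s) b)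
    \<longleftrightarrow> b = circ (s + h / real d)"
  proof (rule next_corner)
    fix t
    have "real d * (s - \<alpha>) \<in> \<int>" using assms by (simp add: pos_eq_iff)
    then have "frac (real d * (s - \<alpha>) + real d * (t - s)) = frac (real d * (t - s))"
      by (rule frac_add_int_left)
    then have "pos t = frac (real d * (t - s))"
      by (simp add: pos_def algebra_simps)
    then show "circ t \<in> corners \<longleftrightarrow> real d * (t - s) \<in> \<int> \<or> real d * (t - s) - h \<in> \<int>"
      using h by (simp add: circ_corner_iff frac_unique_iff)
  qed (use h d2 corners_circle in auto)
  then show ?thesis by (simp add: sibling_arcs_def corners_def Let_def)
qed

lemma sibling_arcs_long:
  assumes "pos s = h"
  shows "(circ s, b) \<in> sibling_arcs F \<longleftrightarrow> b = circ (s + (1 - h) / real d)"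
proof -
  have "circ s \<in> corners \<and> b \<in> corners \<and> circ s \<noteq> b \<and>
      \<not> (\<exists>e\<in>corners. 0 < arc_len (circ s) e \<and> arc_len (circ s) e < arc_len (circ s) b)
    \<longleftrightarrow> b = circ (s + (1 - h) / real d)"
  proof (rule next_corner)
    fix t
    have s: "real d * (s - \<alpha>) - h \<in> \<int>" using assms h by (simp add: pos_eq_iff)
    have "pos t = h \<longleftrightarrow> real d * (t - s) + (real d * (s - \<alpha>) - h) \<in> \<int>"
      using h by (subst pos_eq_iff) (simp_all add: algebra_simps)
    \<comment> \<open>From a corner at position \<open>h\<close> the next start of a short arc is at
      position 1, which \<open>pos\<close> records as 0. Hence the shift by 1.\<close>
    moreover have s1: "(real d * (s - \<alpha>) - h) + 1 \<in> \<int>"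
      using s by (intro Ints_add) auto
    have "pos t = 0 \<longleftrightarrow> (real d * (t - s) - (1 - h)) + ((real d * (s - \<alpha>) - h) + 1) \<in> \<int>"
      using h by (subst pos_eq_iff) (simp_all add: algebra_simps)
    ultimately show "circ t \<in> corners \<longleftrightarrow> real d * (t - s) \<in> \<int> \<or> real d * (t - s) - (1 - h) \<in> \<int>"
      by (simp only: circ_corner_iff add_in_Ints_iff_right[OF s] add_in_Ints_iff_right[OF s1] disj_commute)
  qed (use h d2 corners_circle in auto)
  then show ?thesis by (simp add: sibling_arcs_def corners_def Let_def)
qed

lemma arc_len_circ_add: "0 \<le> r \<Longrightarrow> r < 1 \<Longrightarrow> arc_len (circ s) (circ (s + r)) = r"
  by (simp add: arc_len_circ frac_eq)

definition short_pairs :: "(complex \<times> complex) set" where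
  "short_pairs = (\<lambda>s. (circ s, circ (s + h / real d))) ` {s. pos s = 0}"

definition long_pairs :: "(complex \<times> complex) set" where
  "long_pairs = (\<lambda>s. (circ s, circ (s + (1 - h) / real d))) ` {s. pos s = h}"

lemma sibling_arcs_eq: "sibling_arcs F = short_pairs \<union> long_pairs"
proof -
  have "(a, b) \<in> short_pairs \<union> long_pairs" if ab: "(a, b) \<in> sibling_arcs F" for a b
  proof -
    have a: "a \<in> corners" using ab by (simp add: sibling_arcs_def corners_def Let_def)
    then obtain s where s: "a = circ s" using circle_imp_circ corners_circle by blast
    then consider "pos s = 0" | "pos s = h" using a circ_corner_iff by blast
    then show ?thesis
    proof cases
      case 1
      then show ?thesis using ab s sibling_arcs_short by (auto simp: short_pairs_def)
    next
      case 2
      then have "(a, b) \<in> long_pairs" using ab s sibling_arcs_long[OF 2] unfolding long_pairs_def by blast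
      then show ?thesis ..
    qed
  qed
  moreover have "x \<in> sibling_arcs F" if "x \<in> short_pairs" for x
    using that sibling_arcs_short by (auto simp: short_pairs_def)
  moreover have "x \<in> sibling_arcs F" if "x \<in> long_pairs" for x
    using that sibling_arcs_long unfolding long_pairs_def by blast
  ultimately show ?thesis by auto
qed

lemma arc_len_short: "(a, b) \<in> short_pairs \<Longrightarrow> arc_len a b = h / real d"
proof -
  have "arc_len (circ s) (circ (s + h / real d)) = h / real d" for s
    using h d2 by (intro arc_len_circ_add) (auto simp: field_simps)
  then show "(a, b) \<in> short_pairs \<Longrightarrow> arc_len a b = h / real d"
    by (auto simp: short_pairs_def)
qed

lemma arc_len_long: "(a, b) \<in> long_pairs \<Longrightarrow> arc_len a b = (1 - h) / real d"
proof -
  have "arc_len (circ s) (circ (s + (1 - h) / real d)) = (1 - h) / real d" for s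
    using h d2 by (intro arc_len_circ_add) (auto simp: field_simps)
  then show "(a, b) \<in> long_pairs \<Longrightarrow> arc_len a b = (1 - h) / real d"
    unfolding long_pairs_def by blast
qed

text \<open>As \<open>h < 1 / 2\<close>, the threshold \<open>1 / (2 * real d)\<close> lies strictly
  between the two arc lengths.\<close>

lemma short_arcs_eq: "short_arcs d F = short_pairs"
proof -
  have "h / real d < 1 / (2 * real d)" "\<not> (1 - h) / real d < 1 / (2 * real d)"
    using h d2 by (auto simp: field_simps)
  then show ?thesis
    unfolding short_arcs_def sibling_arcs_eq using arc_len_short arc_len_long by force
qed

lemma long_arcs_eq: "long_arcs d F = long_pairs"
proof -
  have "\<not> 1 / (2 * real d) < h / real d" "1 / (2 * real d) < (1 - h) / real d"
    using h d2 by (auto simp: field_simps)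
  then show ?thesis
    unfolding long_arcs_def sibling_arcs_eq using arc_len_short arc_len_long by force
qed

lemma short_arc_length_eq: "short_arc_length d F = h / real d"
proof -
  have "pos \<alpha> = 0" by (simp add: pos_def)
  then have "short_pairs \<noteq> {}" by (auto simp: short_pairs_def)
  moreover have "case x of (a, b) \<Rightarrow> arc_len a b = h / real d" if "x \<in> short_pairs" for x
    using that arc_len_short by (cases x) auto
  ultimately have "(\<lambda>(a, b). arc_len a b) ` short_arcs d F = {h / real d}"
    unfolding short_arcs_eq by (force simp: image_iff)
  then show ?thesis unfolding short_arc_length_def by simp
qed

lemma long_arc_length_eq: "long_arc_length d F = (1 - h) / real d"
proof -
  have "pos (\<alpha> + h / real d) = h"
    using h d2 by (simp add: pos_eq_iff)
  then have "long_pairs \<noteq> {}" unfolding long_pairs_def by blast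
  moreover have "case x of (a, b) \<Rightarrow> arc_len a b = (1 - h) / real d" if "x \<in> long_pairs" for x
    using that arc_len_long by (cases x) auto
  ultimately have "(\<lambda>(a, b). arc_len a b) ` long_arcs d F = {(1 - h) / real d}"
    unfolding long_arcs_eq by (force simp: image_iff)
  then show ?thesis unfolding long_arc_length_def by simp
qed

section \<open>Locating points in short arcs\<close>

lemma short_arc_bounds: "0 < h / real d" "h / real d < 1 / (2 * real d)" "h / real d < 1"
  using h d2 by (auto simp: field_simps)

lemma ccw_arc_short: "ccw_arc (circ s) (circ (s + h / real d)) = circ ` {s..s + h / real d}"
  using short_arc_bounds by (intro ccw_arc_circ) auto

lemma pos_in_short_arc:
  assumes "pos s = 0" "t \<in> {s..s + h / real d}"
  shows "pos t = real d * (t - s)"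
proof -
  have "real d * (t - s) \<le> h" "0 \<le> real d * (t - s)" using assms d2 by (auto simp: field_simps)
  then show ?thesis using pos_shift[of s "t - s"] assms(1) h by simp
qed

lemma short_arc_of_pos:
  assumes "pos t \<le> h"
  obtains s where "pos s = 0" "t \<in> {s..s + h / real d}" "t = s + pos t / real d"
proof (rule that[of "t - pos t / real d"])
  show "pos (t - pos t / real d) = 0"
    using pos_shift[of t "- pos t / real d"] d2 by simp
  show "t \<in> {t - pos t / real d..t - pos t / real d + h / real d}"
    using assms pos_bounds[of t] d2 by (auto simp: divide_right_mono)
qed simp

lemma pos_cong: "circ s = circ t \<Longrightarrow> pos s = pos t"
proof -
  assume "circ s = circ t"
  then have "real d * (s - t) \<in> \<int>" by (simp add: circ_eq_iff)
  then show ?thesis using pos_add[of "s - t" t] by simp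
qed

text \<open>Two disjoint closed sets suffice: one short arc, and an arc containing all the others.\<close>

lemma connected_in_short_arc:
  assumes "connected K" and K: "\<And>z. z \<in> K \<Longrightarrow> \<exists>t. z = circ t \<and> pos t \<le> h"
    and s: "pos s = 0" "K \<inter> circ ` {s..s + h / real d} \<noteq> {}"
  shows "K \<subseteq> circ ` {s..s + h / real d}"
proof -
  \<comment> \<open>\<open>?V\<close> begins with the next short arc and stops at the end of the
    last one. The remaining long arc, of length \<open>(1 - h) / real d\<close>, completes the
    turn.\<close>
  let ?U = "circ ` {s..s + h / real d}" and ?V = "circ ` {s + 1 / real d..s + 1 - (1 - h) / real d}"
  have closed: "closed ?U" "closed ?V"
    by (intro compact_imp_closed compact_continuous_image continuous_on_circ continuous_on_id compact_Icc)+
  have "?U \<inter> ?V = {}"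
  proof (rule ccontr)
    assume "?U \<inter> ?V \<noteq> {}"
    then obtain z where "z \<in> ?U" "z \<in> ?V" by blast
    then obtain t u where "z = circ t" "z = circ u"
      and tu: "t \<in> {s..s + h / real d}" "u \<in> {s + 1 / real d..s + 1 - (1 - h) / real d}"
      by blast
    then have "u - t \<in> \<int>" using circ_eq_iff by metis
    moreover have "h / real d < 1 / real d" "0 < (1 - h) / real d" using h d2 by (auto simp: divide_strict_right_mono)
    ultimately show False using tu Ints_not_between[of "u - t"] by simp
  qed
  moreover have KUV: "K \<subseteq> ?U \<union> ?V"
  proof
    fix z assume "z \<in> K"
    then obtain t0 where t0: "z = circ t0" "pos t0 \<le> h" using K by blast
    \<comment> \<open>The floor of \<open>real d * r\<close> is the index of the short arc met at
      offset \<open>r\<close> from \<open>s\<close>: index 0 belongs to \<open>?U\<close>, the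
      indices from 1 to \<open>d - 1\<close> to \<open>?V\<close>.\<close>
    define r where "r = frac (t0 - s)"
    have z: "z = circ (s + r)" by (simp add: t0 r_def circ_eq_iff frac_def)
    have r: "0 \<le> r" "r < 1" by (simp_all add: r_def frac_lt_1)
    have le: "pos (s + r) \<le> h" using z t0 pos_cong by metis
    have "frac (real d * r) = pos (s + r)"
      unfolding pos_def using s(1) frac_add_int_left[of "real d * (s - \<alpha>)" "real d * r"]
      by (simp add: pos_eq_iff algebra_simps)
    then have fr: "real d * r - of_int \<lfloor>real d * r\<rfloor> \<le> h" using le by (simp add: frac_def)
    have fl: "of_int \<lfloor>real d * r\<rfloor> \<le> real d * r" by simp
    have "real d * r < real d" using r d2 by simp
    then have n: "0 \<le> \<lfloor>real d * r\<rfloor>" "\<lfloor>real d * r\<rfloor> < int d" using r by (auto simp: floor_less_iff)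
    show "z \<in> ?U \<union> ?V"
    proof (cases "\<lfloor>real d * r\<rfloor> = 0")
      case True
      then have "r \<le> h / real d" using fr d2 by (simp add: field_simps)
      then show ?thesis using r z by auto
    next
      case False
      then have "1 \<le> \<lfloor>real d * r\<rfloor>" "\<lfloor>real d * r\<rfloor> \<le> int d - 1" using n by linarith+
      then have "1 \<le> real d * r" "real d * r \<le> real d - 1 + h" using fl fr by linarith+
      then have "1 / real d \<le> r" "r \<le> 1 - (1 - h) / real d" using d2 by (auto simp: field_simps)
      then show ?thesis using z by auto
    qed
  qed
  ultimately have "?V \<inter> K = {}"
    using connected_closedD[OF \<open>connected K\<close>, of ?U ?V] closed s(2) by (simp add: Int_commute)
  then show ?thesis using KUV by (simp only: subset_iff Un_iff disjoint_iff) blast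
qed

end

section \<open>Regions and the central strip\<close>

lemma connected_nonzero_same_sign:
  fixes g :: "'a :: topological_space \<Rightarrow> real"
  assumes "connected S" "continuous_on S g" "\<And>x. x \<in> S \<Longrightarrow> g x \<noteq> 0" "x \<in> S" "y \<in> S"
  shows "0 < g x * g y"
proof (rule ccontr)
  assume "\<not> 0 < g x * g y"
  then have "g x \<le> 0 \<and> 0 \<le> g y \<or> g y \<le> 0 \<and> 0 \<le> g x"
    by (auto simp: not_less mult_le_0_iff)
  moreover have "connected (g ` S)" using assms(1,2) by (rule connected_continuous_image[rotated])
  ultimately have "0 \<in> g ` S"
    using assms(4,5) by (meson connected_contains_Icc atLeastAtMost_iff imageI subsetD)
  then show False using assms(3) by auto
qed

section \<open>Signs of the leaf functions, and regions as sign cells\<close>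

context sibling_collection
begin

text \<open>The choice of square root fixes the sign arbitrarily, so only comparisons of signs at
  two points carry meaning.\<close>

definition leaf_side :: "complex set \<Rightarrow> complex \<Rightarrow> real" where
  "leaf_side f = side (csqrt (p f * q f)) (p f) (q f)"

lemma leaf_side_affine:
  "leaf_side f ((1 - u) *\<^sub>R x + u *\<^sub>R y) = (1 - u) * leaf_side f x + u * leaf_side f y"
  by (simp add: leaf_side_def side_affine)

lemma continuous_on_leaf_side [continuous_intros]:
  "continuous_on S g \<Longrightarrow> continuous_on S (\<lambda>x. leaf_side f (g x))"
  unfolding leaf_side_def by (intro continuous_intros)

lemma p_neq_q: "f \<in> F \<Longrightarrow> p f \<noteq> q f"
proof
  assume "f \<in> F" "p f = q f"
  then have "circ (real d * \<alpha>) = circ (real d * \<alpha> + h)" using p_power q_power by metis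
  then show False using h Ints_not_between[of h] by (simp add: circ_eq_iff)
qed

lemma leaf_side_eq_0_iff: "f \<in> F \<Longrightarrow> norm z \<le> 1 \<Longrightarrow> leaf_side f z = 0 \<longleftrightarrow> z \<in> f"
  unfolding leaf_side_def using p_circle q_circle p_neq_q leaf
  by (subst side_eq_0_iff) auto

lemma leaf_subset_cball: "f \<in> F \<Longrightarrow> f \<subseteq> cball 0 1"
  using leaf p_circle q_circle convex_contains_segment[of "cball (0::complex) 1"]
  by (metis convex_cball mem_cball_0 mem_sphere_0 order_refl)

lemma circ_in_leaf_imp_corner: "f \<in> F \<Longrightarrow> circ t \<in> f \<Longrightarrow> pos t = 0 \<or> pos t = h"
  unfolding circ_corner_iff[symmetric] corners_def chord_ends_def by auto

text \<open>Multiplying the factorizations of all leaf functions on the circle turns the factors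
  \<open>z - p f\<close> into \<open>z ^ d - ?A\<close> and the factors \<open>z - q f\<close> into
  \<open>z ^ d - ?B\<close>. This is the factorization for the image leaf at \<open>z ^ d\<close>,
  with \<open>W\<close> as square root.\<close>

lemma prod_leaf_side:
  "\<exists>\<kappa>\<in>{1, -1}. \<forall>t. (\<Prod>f\<in>F. leaf_side f (circ t)) = \<kappa> * (4 * sin (pi * pos t) * sin (pi * (h - pos t)))"
proof -
  let ?A = "circ (real d * \<alpha>)" and ?B = "circ (real d * \<alpha> + h)"
  define W where "W = (\<Prod>f\<in>F. csqrt (p f * q f))"
  have fact: "(\<Prod>f\<in>F. z - p f) = z ^ d - ?A" "(\<Prod>f\<in>F. z - q f) = z ^ d - ?B" for z
    using nth_root_factorization[of ?A d z] nth_root_factorization[of ?B d z] d2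
      prod.reindex[OF inj_p, of "\<lambda>x. z - x"] prod.reindex[OF inj_q, of "\<lambda>x. z - x"]
    by (simp_all add: image_p image_q)
  have "W\<^sup>2 = (\<Prod>f\<in>F. 0 - p f) * (\<Prod>f\<in>F. 0 - q f)"
    by (simp add: W_def prod_power_distrib prod.distrib[symmetric] power2_eq_square[symmetric])
  \<comment> \<open>The factorizations at \<open>z = 0\<close> give \<open>- ?A\<close> and
    \<open>- ?B\<close>, and the two signs cancel.\<close>
  then have W: "W\<^sup>2 = ?A * ?B"
    unfolding fact using d2 by (simp add: power_0_left)
  then have "W \<noteq> 0" by auto
  have "(\<Prod>f\<in>F. leaf_side f z) = side W ?A ?B (z ^ d)" if z: "z \<in> circle" for z
  proof -
    have "of_real (\<Prod>f\<in>F. leaf_side f z) * (z ^ d * W) = (\<Prod>f\<in>F. of_real (leaf_side f z) * (z * csqrt (p f * q f)))"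
      by (simp add: W_def prod.distrib card_F)
    also have "\<dots> = (\<Prod>f\<in>F. (z - p f) * (z - q f))"
      unfolding leaf_side_def using z p_circle q_circle by (intro prod.cong refl side_circle) auto
    also have "\<dots> = (z ^ d - ?A) * (z ^ d - ?B)"
      by (simp add: prod.distrib fact)
    also have "\<dots> = of_real (side W ?A ?B (z ^ d)) * (z ^ d * W)"
      using W z by (intro side_circle[symmetric]) (auto simp: norm_power)
    finally show ?thesis
      using z \<open>W \<noteq> 0\<close> by (auto simp del: of_real_prod)
  qed
  moreover have "circ t ^ d = circ (real d * \<alpha> + pos t)" for t
    using circ_power_eq_iff[OF pos_bounds] by blast
  ultimately have "(\<Prod>f\<in>F. leaf_side f (circ t)) = side W ?A ?B (circ (real d * \<alpha> + pos t))" for t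
    by simp
  with side_circ[OF W] show ?thesis by fastforce
qed

text \<open>The product of sines changes sign exactly when \<open>pos\<close> passes
  \<open>h\<close>. This is the criterion that separates short from long arcs, and multiplying by
  \<open>\<kappa>\<close> removes the unknown sign.\<close>

lemma sign_prod_leaf_side:
  obtains \<kappa> :: real where "\<And>t. 0 < pos t \<Longrightarrow> pos t < h \<Longrightarrow> 0 < \<kappa> * (\<Prod>f\<in>F. leaf_side f (circ t))"
    and "\<And>t. h < pos t \<Longrightarrow> \<kappa> * (\<Prod>f\<in>F. leaf_side f (circ t)) < 0"
proof -
  obtain \<kappa> :: real where \<kappa>: "\<kappa> \<in> {1, -1}"
    "\<And>t. (\<Prod>f\<in>F. leaf_side f (circ t)) = \<kappa> * (4 * sin (pi * pos t) * sin (pi * (h - pos t)))"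
    using prod_leaf_side by blast
  have sin_pos: "0 < sin (pi * x)" if "0 < x" "x < 1" for x
    using that by (intro sin_gt_zero) auto
  have "\<kappa> * \<kappa> = 1" using \<kappa>(1) by auto
  then have *: "\<kappa> * (\<Prod>f\<in>F. leaf_side f (circ t)) = 4 * sin (pi * pos t) * sin (pi * (h - pos t))" for t
    unfolding \<kappa>(2) by (simp add: mult.assoc[symmetric])
  show ?thesis
  proof
    show "0 < \<kappa> * (\<Prod>f\<in>F. leaf_side f (circ t))" if "0 < pos t" "pos t < h" for t
      unfolding * using that h sin_pos[of "pos t"] sin_pos[of "h - pos t"] by simp
    show "\<kappa> * (\<Prod>f\<in>F. leaf_side f (circ t)) < 0" if "h < pos t" for t
    proof -
      have "0 < sin (pi * (pos t - h))" using that h pos_bounds[of t] by (intro sin_pos) auto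
      also have "\<dots> = - sin (pi * (h - pos t))"
        by (metis minus_diff_eq mult_minus_right sin_minus)
      finally show ?thesis
        unfolding * using sin_pos[of "pos t"] that h pos_bounds[of t] by (simp add: mult_pos_neg)
    qed
  qed
qed

lemma closed_Union_F: "closed (\<Union>F)"
  using finite_F leaf closed_segment by (metis closed_Union)

lemma open_region: "R \<in> portrait_regions F \<Longrightarrow> open R"
  unfolding portrait_regions_def using closed_Union_F open_components by blast

lemma leaf_side_neq_0: "f \<in> F \<Longrightarrow> z \<in> ball 0 1 - \<Union>F \<Longrightarrow> leaf_side f z \<noteq> 0"
  using leaf_side_eq_0_iff[of f z] by auto

lemma convex_leaf_side: "convex {z. 0 < c * leaf_side f z}"
proof (rule convexI)
  fix x y :: complex and u v :: real
  assume xy: "x \<in> {z. 0 < c * leaf_side f z}" "y \<in> {z. 0 < c * leaf_side f z}" and uv: "0 \<le> u" "0 \<le> v" "u + v = 1"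
  have "c * leaf_side f (u *\<^sub>R x + v *\<^sub>R y) = u * (c * leaf_side f x) + v * (c * leaf_side f y)"
  proof -
    have "u = 1 - v" using uv(3) by simp
    then show ?thesis by (simp only: leaf_side_affine) (simp add: algebra_simps)
  qed
  moreover have "0 < u * (c * leaf_side f x) + v * (c * leaf_side f y)"
    using xy uv by (cases "u = 0") (auto intro!: add_pos_nonneg)
  ultimately show "u *\<^sub>R x + v *\<^sub>R y \<in> {z. 0 < c * leaf_side f z}" by simp
qed

text \<open>The sign cell is convex, hence connected. Conversely, no leaf function can change sign
  on a connected set that avoids the leaves.\<close>

lemma region_eq:
  assumes "R \<in> portrait_regions F" "a \<in> R"
  shows "R = {z \<in> ball 0 1. \<forall>f\<in>F. 0 < leaf_side f a * leaf_side f z}" (is "_ = ?S")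
proof -
  have a: "a \<in> ball 0 1 - \<Union>F"
    using in_components_subset[OF assms(1)[unfolded portrait_regions_def]] assms(2) by blast
  obtain b where b: "R = connected_component_set (ball 0 1 - \<Union>F) b"
    using assms(1) by (auto simp: portrait_regions_def components_iff)
  then have R: "R = connected_component_set (ball 0 1 - \<Union>F) a"
    using assms(2) by (metis connected_component_eq)
  have S: "?S = ball 0 1 \<inter> (\<Inter>f\<in>F. {z. 0 < leaf_side f a * leaf_side f z})" by auto
  have "connected_component_set (ball 0 1 - \<Union>F) a = ?S"
  proof (rule connected_component_unique)
    show "a \<in> ?S" using a leaf_side_neq_0[OF _ a] by (auto simp: zero_less_mult_iff linorder_neq_iff)
    show "?S \<subseteq> ball 0 1 - \<Union>F"
    proof
      fix z assume z: "z \<in> ?S"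
      have "z \<notin> f" if "f \<in> F" for f
        using z that leaf_side_eq_0_iff[OF that, of z] by auto
      then show "z \<in> ball 0 1 - \<Union>F" using z by auto
    qed
    have "convex ?S" unfolding S by (intro convex_Int convex_INT convex_ball convex_leaf_side)
    then show "connected ?S" by (rule convex_connected)
    fix c assume c: "a \<in> c" "c \<subseteq> ball 0 1 - \<Union>F" "connected c"
    have "0 < leaf_side f a * leaf_side f z" if "f \<in> F" "z \<in> c" for f z
      using c that leaf_side_neq_0 by (intro connected_nonzero_same_sign[of c]) (auto intro!: continuous_intros)
    then show "c \<subseteq> ?S" using c(2) by auto
  qed
  then show ?thesis using R by simp
qed

text \<open>A point satisfying the weak inequalities is approached along the segment from
  \<open>a\<close>, on which the inequalities are strict.\<close>

lemma closure_region_eq: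
  assumes "R \<in> portrait_regions F" "a \<in> R"
  shows "closure R = {z \<in> cball 0 1. \<forall>f\<in>F. 0 \<le> leaf_side f a * leaf_side f z}" (is "_ = ?S")
proof
  have S: "?S = cball 0 1 \<inter> (\<Inter>f\<in>F. {z. 0 \<le> leaf_side f a * leaf_side f z})" by auto
  have "closed ?S"
    unfolding S by (intro closed_Int closed_INT ballI closed_cball closed_Collect_le continuous_intros)
  moreover have "R \<subseteq> ?S"
    unfolding region_eq[OF assms] by (auto intro: less_imp_le)
  ultimately show "closure R \<subseteq> ?S" by (rule closure_minimal[rotated])
  show "?S \<subseteq> closure R"
  proof
    fix z assume z: "z \<in> ?S"
    show "z \<in> closure R"
    proof (cases "z = a")
      case True
      then show ?thesis using assms closure_subset by auto
    next
      case False
      have "open_segment a z \<subseteq> R"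
      proof
        fix x assume "x \<in> open_segment a z"
        then obtain u where u: "0 < u" "u < 1" "x = (1 - u) *\<^sub>R a + u *\<^sub>R z"
          by (auto simp: in_segment)
        have a: "a \<in> ball 0 1" "\<And>f. f \<in> F \<Longrightarrow> 0 < leaf_side f a * leaf_side f a"
          using assms(2) region_eq[OF assms] by auto
        have "norm x \<le> (1 - u) * norm a + u * norm z"
          unfolding u(3) using u(1,2) by (intro norm_triangle_le) simp
        also have "\<dots> < (1 - u) * 1 + u * 1"
          using u a z by (intro add_less_le_mono mult_strict_left_mono mult_left_mono) auto
        finally have "x \<in> ball 0 1" by simp
        moreover have "0 < leaf_side f a * leaf_side f x" if "f \<in> F" for f
        proof -
          have "leaf_side f a * leaf_side f x = (1 - u) * (leaf_side f a * leaf_side f a) + u * (leaf_side f a * leaf_side f z)"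
            unfolding u(3) leaf_side_affine by (simp add: algebra_simps)
          also have "\<dots> > 0"
            using u a z that by (intro add_pos_nonneg mult_pos_pos[of "1 - u"] mult_nonneg_nonneg[of u]) auto
          finally show ?thesis .
        qed
        ultimately show "x \<in> R" unfolding region_eq[OF assms] by blast
      qed
      then have "closure (open_segment a z) \<subseteq> closure R" by (rule closure_mono)
      then show ?thesis using False by (auto simp: closure_open_segment)
    qed
  qed
qed

text \<open>Along a leaf its own function vanishes, and the functions of the other leaves keep their
  sign by disjointness. So one point in the closure of the region brings the whole leaf
  along.\<close>

lemma leaf_subset_frontier:
  assumes R: "R \<in> portrait_regions F" and f: "f \<in> F" "z \<in> f" "z \<in> closure R"
  shows "f \<subseteq> frontier R"
proof
  fix x assume x: "x \<in> f"
  obtain a where a: "a \<in> R" using R in_components_nonempty by (auto simp: portrait_regions_def)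
  have "0 \<le> leaf_side g a * leaf_side g x" if g: "g \<in> F" for g
  proof (cases "g = f")
    case True
    then show ?thesis using x f leaf_side_eq_0_iff[of f x] leaf_subset_cball by fastforce
  next
    case False
    have "connected f" using leaf[OF f(1)] connected_segment by metis
    moreover have "leaf_side g y \<noteq> 0" if "y \<in> f" for y
      using that f g False leaf_side_eq_0_iff[of g y] leaf_subset_cball same_leaf by fastforce
    ultimately have "0 < leaf_side g z * leaf_side g x"
      using f x by (intro connected_nonzero_same_sign[of f]) (auto intro!: continuous_intros)
    moreover have "0 \<le> leaf_side g a * leaf_side g z"
      using f(3) g closure_region_eq[OF R a] by auto
    ultimately show ?thesis by (auto simp: zero_le_mult_iff zero_less_mult_iff)
  qed
  then have "x \<in> closure R"
    using x leaf_subset_cball[OF f(1)] closure_region_eq[OF R a] by auto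
  moreover have "x \<notin> R"
    using R in_components_subset x f(1) by (fastforce simp: portrait_regions_def)
  ultimately show "x \<in> frontier R"
    using open_region[OF R] by (simp add: frontier_def interior_open)
qed

text \<open>Away from corners, each leaf function has on the closure of the region the sign it has
  at \<open>a\<close>. The product therefore has the same sign at \<open>t\<close> and at
  \<open>u\<close>, which fails for a short and a long arc.\<close>

lemma short_region_pos_le:
  assumes R: "R \<in> portrait_regions F" and t: "circ t \<in> closure R" "0 < pos t" "pos t < h"
    and u: "circ u \<in> closure R"
  shows "pos u \<le> h"
proof (rule ccontr)
  assume "\<not> pos u \<le> h"
  obtain a where a: "a \<in> R" using R in_components_nonempty by (auto simp: portrait_regions_def)
  have pos_prod: "0 < (\<Prod>f\<in>F. leaf_side f a) * (\<Prod>f\<in>F. leaf_side f (circ s))"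
    if "circ s \<in> closure R" "pos s \<noteq> 0" "pos s \<noteq> h" for s
  proof -
    have "0 < leaf_side f a * leaf_side f (circ s)" if "f \<in> F" for f
    proof -
      have "leaf_side f (circ s) \<noteq> 0"
        using \<open>pos s \<noteq> 0\<close> \<open>pos s \<noteq> h\<close> that circ_in_leaf_imp_corner leaf_side_eq_0_iff[OF that, of "circ s"] by auto
      moreover have "leaf_side f a \<noteq> 0"
        using a that region_eq[OF R a] by auto
      moreover have "0 \<le> leaf_side f a * leaf_side f (circ s)"
        using \<open>circ s \<in> closure R\<close> that closure_region_eq[OF R a] by auto
      ultimately show ?thesis by (simp add: order_less_le)
    qed
    then show ?thesis by (simp add: prod.distrib[symmetric] prod_pos)
  qed
  obtain \<kappa> where \<kappa>: "\<And>t. 0 < pos t \<Longrightarrow> pos t < h \<Longrightarrow> 0 < \<kappa> * (\<Prod>f\<in>F. leaf_side f (circ t))"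
    "\<And>t. h < pos t \<Longrightarrow> \<kappa> * (\<Prod>f\<in>F. leaf_side f (circ t)) < 0"
    using sign_prod_leaf_side by blast
  show False
    using \<kappa>(1)[of t] \<kappa>(2)[of u] pos_prod[of t] pos_prod[of u] t u \<open>\<not> pos u \<le> h\<close> h
    by (auto simp: zero_less_mult_iff mult_less_0_iff)
qed

text \<open>At a corner \<open>u\<close> of the closure of such a region, the leaf ending at \<open>u\<close> leaves the sign
  towards the neighbouring short arc undetermined; it is recovered from the sign of the product
  over all leaves.\<close>

lemma short_arc_subset_closure:
  assumes R: "R \<in> portrait_regions F" and t: "circ t \<in> closure R" "0 < pos t" "pos t < h"
    and s: "pos s = 0" and u: "u \<in> {s..s + h / real d}" "circ u \<in> closure R"
  shows "circ ` {s..s + h / real d} \<subseteq> closure R"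
proof -
  obtain a where a: "a \<in> R" using R in_components_nonempty by (auto simp: portrait_regions_def)
  have inner: "0 < pos m" "pos m < h" if "m \<in> {s<..<s + h / real d}" for m
  proof -
    have "m - s < h / real d" "0 < m - s" using that by auto
    then have "real d * (m - s) < h" "0 < real d * (m - s)" using d2 by (auto simp: field_simps)
    then show "0 < pos m" "pos m < h" using pos_in_short_arc[OF s, of m] that by auto
  qed
  \<comment> \<open>A leaf that misses \<open>circ v\<close> has no end on the way from
    \<open>v\<close> to \<open>m\<close>, so its sign at \<open>m\<close> is that at
    \<open>v\<close>.\<close>
  have sgn_eq: "0 < leaf_side f a * leaf_side f (circ m)"
    if v: "circ v \<in> closure R" "v \<in> {s..s + h / real d}" and m: "m \<in> {s<..<s + h / real d}" and f: "f \<in> F" "circ v \<notin> f" for f v m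
  proof -
    have sub: "closed_segment v m \<subseteq> {s<..<s + h / real d} \<union> {v}"
      using v(2) m by (auto simp: closed_segment_eq_real_ivl)
    have "leaf_side f (circ x) \<noteq> 0" if "x \<in> closed_segment v m" for x
    proof -
      have "circ x \<notin> f"
      proof (cases "x = v")
        case False
        then have "x \<in> {s<..<s + h / real d}" using that sub by blast
        then show ?thesis using inner[of x] circ_in_leaf_imp_corner[OF f(1), of x] by auto
      qed (use f in simp)
      then show ?thesis using leaf_side_eq_0_iff[OF f(1), of "circ x"] by simp
    qed
    then have "0 < leaf_side f (circ v) * leaf_side f (circ m)"
      by (intro connected_nonzero_same_sign[of "closed_segment v m" "\<lambda>x. leaf_side f (circ x)"]
          connected_segment continuous_intros) auto
    moreover have "0 \<le> leaf_side f a * leaf_side f (circ v)"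
      using v f closure_region_eq[OF R a] by auto
    moreover have "leaf_side f a \<noteq> 0"
      using a f region_eq[OF R a] by auto
    ultimately show ?thesis by (auto simp: zero_le_mult_iff zero_less_mult_iff)
  qed
  obtain \<kappa> where \<kappa>: "\<And>t. 0 < pos t \<Longrightarrow> pos t < h \<Longrightarrow> 0 < \<kappa> * (\<Prod>f\<in>F. leaf_side f (circ t))"
    using sign_prod_leaf_side by blast
  have t_not_leaf: "circ t \<notin> f" if "f \<in> F" for f
    using circ_in_leaf_imp_corner[OF that, of t] t by auto
  have pos_prod: "0 < (\<Prod>f\<in>F. leaf_side f a * leaf_side f (circ m))" if m: "m \<in> {s<..<s + h / real d}" for m
  proof -
    have "0 < (\<Prod>f\<in>F. leaf_side f a * leaf_side f (circ t))"
    proof (intro prod_pos)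
      fix f assume f: "f \<in> F"
      have "0 \<le> leaf_side f a * leaf_side f (circ t)"
        using t f closure_region_eq[OF R a] by auto
      moreover have "leaf_side f a \<noteq> 0" using a f region_eq[OF R a] by auto
      moreover have "leaf_side f (circ t) \<noteq> 0"
        using t_not_leaf[OF f] leaf_side_eq_0_iff[OF f, of "circ t"] by simp
      ultimately show "0 < leaf_side f a * leaf_side f (circ t)" by (simp add: order_less_le)
    qed
    then have "0 < (\<Prod>f\<in>F. leaf_side f a) * (\<Prod>f\<in>F. leaf_side f (circ t))"
      by (simp add: prod.distrib)
    \<comment> \<open>Both \<open>t\<close> and \<open>m\<close> are interior to short arcs, so the
      product of the leaf functions has the same sign at the two points.\<close>
    moreover note \<kappa>[OF t(2,3)] \<kappa>[OF inner[OF m]]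
    ultimately have "0 < (\<Prod>f\<in>F. leaf_side f a) * (\<Prod>f\<in>F. leaf_side f (circ m))"
      by (auto simp: zero_less_mult_iff)
    then show ?thesis by (simp add: prod.distrib)
  qed
  have all: "0 < leaf_side f a * leaf_side f (circ m)" if m: "m \<in> {s<..<s + h / real d}" and f: "f \<in> F" for f m
  proof (cases "circ u \<in> f")
    case True
    have "0 < leaf_side g a * leaf_side g (circ m)" if "g \<in> F - {f}" for g
      using that True f same_leaf[of f g "circ u"] by (intro sgn_eq[OF u(2,1) m]) auto
    then have "0 < (\<Prod>g\<in>F - {f}. leaf_side g a * leaf_side g (circ m))"
      by (intro prod_pos) auto
    moreover have "(\<Prod>g\<in>F. leaf_side g a * leaf_side g (circ m))
        = (leaf_side f a * leaf_side f (circ m)) * (\<Prod>g\<in>F - {f}. leaf_side g a * leaf_side g (circ m))"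
      by (rule prod.remove[OF finite_F f])
    ultimately show ?thesis using pos_prod[OF m] by (metis zero_less_mult_pos2)
  qed (use sgn_eq[OF u(2,1) m f] in simp)
  have "circ ` {s<..<s + h / real d} \<subseteq> closure R"
    using all unfolding closure_region_eq[OF R a] by (auto intro: less_imp_le)
  then have "circ ` closure {s<..<s + h / real d} \<subseteq> closure R"
    by (intro image_closure_subset continuous_on_circ continuous_on_id closed_closure)
  then show ?thesis using short_arc_bounds(1) by simp
qed

text \<open>A component has only points with \<open>pos\<close> at most \<open>h\<close>, so by
  connectedness it stays in one short arc. That whole arc lies in the closure, so maximality gives
  equality.\<close>

lemma short_region_C_region:
  assumes R: "R \<in> portrait_regions F" and t: "circ t \<in> closure R" "0 < pos t" "pos t < h"
  shows "C_region d F R"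
  unfolding C_region_def
proof (intro conjI ballI R)
  fix K assume K: "K \<in> components (closure R \<inter> circle)"
  have K_sub: "K \<subseteq> closure R \<inter> circle" using in_components_subset[OF K] .
  have K_pos: "\<exists>u. z = circ u \<and> pos u \<le> h" if "z \<in> K" for z
    using that K_sub short_region_pos_le[OF R t] circle_imp_circ by blast
  obtain z where z: "z \<in> K" using in_components_nonempty[OF K] by blast
  then obtain u where u: "z = circ u" "pos u \<le> h" using K_pos by blast
  obtain s where s: "pos s = 0" "u \<in> {s..s + h / real d}" using short_arc_of_pos[OF u(2)] by blast
  have "K \<subseteq> circ ` {s..s + h / real d}"
    using z u s K_pos in_components_connected[OF K] by (intro connected_in_short_arc) auto
  moreover have "circ ` {s..s + h / real d} \<subseteq> K"
  proof (rule components_maximal[OF K])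
    show "connected (circ ` {s..s + h / real d})"
      by (intro connected_continuous_image continuous_on_circ continuous_on_id connected_Icc)
    have "circ u \<in> closure R" using z u K_sub by auto
    then show "circ ` {s..s + h / real d} \<subseteq> closure R \<inter> circle"
      using short_arc_subset_closure[OF R t s] by auto
    show "K \<inter> circ ` {s..s + h / real d} \<noteq> {}" using z u s by auto
  qed
  ultimately have "K = ccw_arc (circ s) (circ (s + h / real d))"
    by (simp add: ccw_arc_short)
  then show "\<exists>(a, b)\<in>short_arcs d F. K = ccw_arc a b"
    using s unfolding short_arcs_eq short_pairs_def by auto
qed

text \<open>Each corner at position 0 is \<open>p f\<close> for some leaf \<open>f\<close>, so
  distinct corners of this kind supply distinct boundary leaves.\<close>

lemma region_degree_ge_2:
  assumes R: "R \<in> portrait_regions F"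
    and s: "circ s \<in> closure R" "pos s = 0" "circ s' \<in> closure R" "pos s' = 0" "circ s \<noteq> circ s'"
  shows "2 \<le> region_degree F R"
proof -
  have *: "\<exists>f\<in>F. p f = circ r \<and> f \<subseteq> frontier R" if "circ r \<in> closure R" "pos r = 0" for r
  proof -
    have "circ r \<in> p ` F"
      unfolding image_p using that circ_power_eq_iff[of 0 r] by simp
    then obtain f where f: "f \<in> F" "circ r = p f" by auto
    then have "f \<subseteq> frontier R" using that leaf_ends by (intro leaf_subset_frontier[OF R f(1)]) auto
    then show ?thesis using f by metis
  qed
  obtain f where f: "f \<in> F" "p f = circ s" "f \<subseteq> frontier R" using *[of s] s by blast
  obtain f' where f': "f' \<in> F" "p f' = circ s'" "f' \<subseteq> frontier R" using *[of s'] s by blast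
  have "card {f, f'} \<le> region_degree F R"
    unfolding region_degree_def using f f' finite_F by (intro card_mono) auto
  moreover have "f \<noteq> f'" using f f' s by metis
  ultimately show ?thesis by simp
qed

text \<open>The open chord lies in one region, a C-region because \<open>circ x\<close> is interior
  to a short arc. The other end lies in a different short arc, and the starts of the two arcs give
  degree at least 2.\<close>

lemma chord_subset_central_strip:
  assumes seg: "open_segment (circ x) (circ y) \<subseteq> ball 0 1 - \<Union>F"
    and x: "0 < pos x" "pos x < h"
    and xy: "\<And>s. pos s = 0 \<Longrightarrow> x \<in> {s..s + h / real d} \<Longrightarrow> circ y \<notin> circ ` {s..s + h / real d}"
  shows "closed_segment (circ x) (circ y) \<subseteq> central_strip d F"
proof -
  obtain s where s: "pos s = 0" "x \<in> {s..s + h / real d}" using short_arc_of_pos[of x] x by auto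
  then have neq: "circ x \<noteq> circ y" using xy[OF s] by (metis imageI)
  then have "open_segment (circ x) (circ y) \<noteq> {}" by simp
  then obtain R where R: "R \<in> portrait_regions F" "open_segment (circ x) (circ y) \<subseteq> R"
    using exists_component_superset[OF seg _ convex_connected[OF convex_open_segment]] seg unfolding portrait_regions_def by blast
  have "closure (open_segment (circ x) (circ y)) \<subseteq> closure R" using R(2) by (rule closure_mono)
  then have sub: "closed_segment (circ x) (circ y) \<subseteq> closure R" using neq by (simp add: closure_open_segment)
  then have cx: "circ x \<in> closure R" "circ y \<in> closure R" by auto
  have "C_region d F R" using short_region_C_region[OF R(1) cx(1) x] .
  moreover have "2 \<le> region_degree F R"
  proof -
    have "pos y \<le> h" using short_region_pos_le[OF R(1) cx(1) x cx(2)] .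
    then obtain s' where s': "pos s' = 0" "y \<in> {s'..s' + h / real d}" using short_arc_of_pos by blast
    have "circ s \<noteq> circ s'"
    proof
      assume "circ s = circ s'"
      \<comment> \<open>Arcs with the same starting point coincide, so the offset
        \<open>y - s'\<close> can be measured from \<open>s\<close> as well.\<close>
      then have "circ y = circ (s + (y - s'))"
        using circ_add[of s "y - s'"] circ_add[of s' "y - s'"] by simp
      then have "circ y \<in> circ ` {s..s + h / real d}" using s'(2) by auto
      then show False using xy s by blast
    qed
    then show ?thesis
      using short_arc_subset_closure[OF R(1) cx(1) x s cx(1)] short_arc_subset_closure[OF R(1) cx(1) x s' cx(2)]
        s s' short_arc_bounds(1) by (intro region_degree_ge_2[OF R(1), of s s']) auto
  qed
  ultimately have "R \<subseteq> \<Union> {R. C_region d F R \<and> 2 \<le> region_degree F R}" by blast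
  then have "closure R \<subseteq> central_strip d F" unfolding central_strip_def by (rule closure_mono)
  then show ?thesis using sub by blast
qed

section \<open>The trace of the central strip on the circle\<close>

lemma C_region_pos_le:
  assumes "C_region d F R" "circ t \<in> closure R"
  shows "pos t \<le> h"
proof -
  define K where "K = connected_component_set (closure R \<inter> circle) (circ t)"
  have "K \<in> components (closure R \<inter> circle)"
    unfolding K_def using assms(2) by (intro componentsI) simp
  then obtain a b where ab: "(a, b) \<in> short_pairs" "K = ccw_arc a b"
    using assms(1) by (auto simp: C_region_def short_arcs_eq)
  then obtain s where s: "pos s = 0" "K = circ ` {s..s + h / real d}"
    by (auto simp: short_pairs_def ccw_arc_short)
  have "circ t \<in> K" unfolding K_def using assms(2) by simp
  then obtain u where u: "u \<in> {s..s + h / real d}" "circ t = circ u" using s by auto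
  have "pos t = real d * (u - s)" using pos_cong[OF u(2)] pos_in_short_arc[OF s(1) u(1)] by simp
  then show ?thesis using u(1) d2 by (simp add: field_simps)
qed

text \<open>A small ball around \<open>z\<close> misses all leaves. Its part inside the disk is
  convex, so it belongs to a single region, and this is the region meeting the strip near
  \<open>z\<close>.\<close>

lemma central_strip_off_leaves:
  assumes z: "z \<in> central_strip d F" "z \<in> cball 0 1" "z \<notin> \<Union>F"
  obtains R where "C_region d F R" "z \<in> closure R"
proof -
  obtain e where e: "0 < e" "ball z e \<inter> \<Union>F = {}"
    using closed_Union_F z(3) by (metis open_Compl open_contains_ball ComplI disjoint_eq_subset_Compl inf_commute)
  obtain x where x: "x \<in> \<Union> {R. C_region d F R \<and> 2 \<le> region_degree F R}" "x \<in> ball z e"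
    using z(1) e(1) unfolding central_strip_def by (metis closure_approachable mem_ball dist_commute)
  then obtain R where R: "C_region d F R" "x \<in> R" by blast
  have comp: "R \<in> components (ball 0 1 - \<Union>F)" using R(1) by (simp add: C_region_def portrait_regions_def)
  have "connected (ball z e \<inter> ball 0 1)" by (intro convex_connected convex_Int convex_ball)
  moreover have "x \<in> ball 0 1" using in_components_subset[OF comp] R(2) by blast
  ultimately have "ball z e \<inter> ball 0 1 \<subseteq> R"
    using e(2) x(2) R(2) by (intro components_maximal[OF comp]) auto
  then have "closure (ball z e \<inter> ball 0 1) \<subseteq> closure R" by (rule closure_mono)
  moreover have "z \<in> closure (ball z e \<inter> ball 0 1)"
  proof -
    have "z \<in> ball z e \<inter> closure (ball 0 1)" using e(1) z(2) by simp
    then show ?thesis using open_Int_closure_subset[of "ball z e" "ball 0 1"] by blast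
  qed
  ultimately show ?thesis using that R(1) by blast
qed

lemma central_strip_pos_le:
  assumes "circ t \<in> central_strip d F"
  shows "pos t \<le> h"
proof (cases "circ t \<in> \<Union>F")
  case True
  then obtain f where "f \<in> F" "circ t \<in> f" by blast
  then show ?thesis using circ_in_leaf_imp_corner[of f t] h by linarith
next
  case False
  then obtain R where "C_region d F R" "circ t \<in> closure R"
    using central_strip_off_leaves[OF assms] by auto
  then show ?thesis by (rule C_region_pos_le)
qed

text \<open>A component lies in a single short arc. The number \<open>r\<close> is the signed
  displacement along it.\<close>

lemma component_ends_close:
  assumes K: "K \<in> components (central_strip d F \<inter> circle)" and xy: "circ x \<in> K" "circ y \<in> K"
  obtains r where "\<bar>r\<bar> \<le> h / real d" "y - x - r \<in> \<int>"
proof -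
  have K_pos: "\<exists>u. z = circ u \<and> pos u \<le> h" if "z \<in> K" for z
    using that in_components_subset[OF K] central_strip_pos_le circle_imp_circ by blast
  have "pos x \<le> h" using xy(1) in_components_subset[OF K] central_strip_pos_le by blast
  then obtain s where s: "pos s = 0" "x \<in> {s..s + h / real d}" using short_arc_of_pos by blast
  have "K \<subseteq> circ ` {s..s + h / real d}"
    using xy s K_pos in_components_connected[OF K] by (intro connected_in_short_arc) auto
  then obtain u where u: "u \<in> {s..s + h / real d}" "circ y = circ u" using xy by auto
  have "y - x - (u - x) \<in> \<int>" using u(2) by (simp add: circ_eq_iff)
  moreover have "\<bar>u - x\<bar> \<le> h / real d" using u(1) s(2) by (auto simp: abs_le_iff)
  ultimately show ?thesis using that by blast
qed

end

section \<open>Critical chords near the orbit\<close>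

text \<open>The counterclockwise length \<open>g\<close> from \<open>circ (x + r)\<close> to
  \<open>circ x\<close> is a multiple of \<open>1 / d\<close> strictly between 0 and 1. A
  displacement \<open>\<delta>\<close> shorter than \<open>1 / d\<close> therefore never passes
  \<open>circ x\<close>, and its sign decides which chord gets the label 1.\<close>

lemma has_endpoint_dist_shared_end:
  assumes d: "d > 0" and r: "real d * r \<in> \<int>" "r \<notin> \<int>" and \<delta>: "\<delta> \<noteq> 0" "\<bar>\<delta>\<bar> < 1 / real d"
  shows "has_endpoint_dist (closed_segment (circ x) (circ (x + r + \<delta>))) (closed_segment (circ x) (circ (x + r))) \<bar>\<delta>\<bar>"
    (is "has_endpoint_dist ?m ?D _")
proof -
  let ?x' = "x + r" and ?y = "x + r + \<delta>"
  define g where "g = frac (- r)"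
  have "real d * g = - (real d * r) - real d * of_int \<lfloor>- r\<rfloor>" by (simp add: g_def frac_def algebra_simps)
  also have "\<dots> \<in> \<int>" using r(1) by (intro Ints_diff Ints_mult) auto
  finally obtain n where n: "real d * g = of_int n" by (elim Ints_cases)
  have "0 < g" "g < 1" using r(2) by (simp_all add: g_def frac_lt_1)
  then have "0 < real d * g" "real d * g < real d" using d by auto
  then have "0 < n" "n < int d" unfolding n by linarith+
  then have "of_int 1 \<le> (of_int n :: real)" "of_int n \<le> (of_int (int d - 1) :: real)"
    by (simp_all only: of_int_le_iff)
  then have "1 \<le> real d * g" "real d * g \<le> real d - 1" unfolding n by simp_all
  then have g: "1 / real d \<le> g" "g \<le> 1 - 1 / real d" using d by (auto simp: field_simps)
  have \<delta>1: "\<bar>\<delta>\<bar> < 1" using \<delta>(2) g by linarith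
  have "circ ?y \<noteq> circ ?x'"
    using \<delta>(1) \<delta>1 Ints_abs_less_1[of \<delta>] by (auto simp: circ_eq_iff abs_less_iff)
  moreover have "circ x \<noteq> circ ?x'" using r(2) by (simp add: circ_eq_iff)
  moreover have "chord_ends ?m = {circ x, circ ?y}" "chord_ends ?D = {circ x, circ ?x'}"
    by (simp_all add: chord_ends_closed_segment)
  ultimately have neq: "?m \<noteq> ?D" by (metis doubleton_eq_iff)
  have chords: "is_chord ?m" "is_chord ?D" unfolding is_chord_def using circ_mem by blast+
  have "ordered_endpoint_dist ?D ?m \<bar>\<delta>\<bar>" if pos: "0 < \<delta>"
    unfolding ordered_endpoint_dist_def
  proof (intro bexI conjI)
    show "?D = closed_segment (circ ?x') (circ x)" "?m = closed_segment (circ ?y) (circ x)"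
      by (rule closed_segment_commute)+
    have "frac \<delta> = \<delta>" using pos \<delta>1 by (simp add: frac_eq)
    moreover have "\<delta> < g" using \<delta>(2) g pos by linarith
    ultimately show "0 < arc_len (circ ?x') (circ ?y)" "arc_len (circ ?x') (circ ?y) < arc_len (circ ?x') (circ x)"
      "arc_len (circ ?x') (circ x) \<le> arc_len (circ ?x') (circ x)"
      "\<bar>\<delta>\<bar> = arc_len (circ ?x') (circ ?y) + arc_len (circ x) (circ x)"
      using pos by (simp_all add: arc_len_circ g_def)
  qed (rule circ_mem)+
  moreover have "ordered_endpoint_dist ?m ?D \<bar>\<delta>\<bar>" if neg: "\<delta> < 0"
    unfolding ordered_endpoint_dist_def
  proof (intro bexI conjI)
    show "?m = closed_segment (circ ?y) (circ x)" "?D = closed_segment (circ ?x') (circ x)"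
      by (rule closed_segment_commute)+
    have "frac (- \<delta>) = - \<delta>" using neg \<delta>1 by (simp add: frac_eq)
    moreover have "frac (- r - \<delta>) = g - \<delta>"
      using neg \<delta> g unfolding frac_unique_iff by (auto simp: g_def frac_def)
    ultimately show "0 < arc_len (circ ?y) (circ ?x')" "arc_len (circ ?y) (circ ?x') < arc_len (circ ?y) (circ x)"
      "arc_len (circ ?y) (circ x) \<le> arc_len (circ ?y) (circ x)"
      "\<bar>\<delta>\<bar> = arc_len (circ ?y) (circ ?x') + arc_len (circ x) (circ x)"
      using neg \<open>0 < g\<close> by (simp_all add: arc_len_circ)
  qed (rule circ_mem)+
  ultimately show ?thesis
    unfolding has_endpoint_dist_def using chords neq \<delta>(1) by (auto simp: linorder_neq_iff)
qed

context sibling_collection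
begin

text \<open>A point \<open>w\<close> of the strip on a chord with both endpoints in long arcs would put one half of
  the chord, between \<open>w\<close> and an endpoint, into a \<open>C\<close>-region.\<close>

lemma chord_disjoint_central_strip:
  assumes x: "h < pos x" and y: "h < pos y" and f: "f \<in> F"
    and only: "\<And>g. g \<in> F \<Longrightarrow> g \<noteq> f \<Longrightarrow> closed_segment (circ x) (circ y) \<inter> g = {}"
  shows "closed_segment (circ x) (circ y) \<inter> central_strip d F = {}"
proof (rule ccontr)
  assume "\<not> ?thesis"
  then obtain w where w: "w \<in> closed_segment (circ x) (circ y)" "w \<in> central_strip d F" by blast
  have D_cball: "closed_segment (circ x) (circ y) \<subseteq> cball 0 1"
    by (intro closed_segment_subset convex_cball) auto
  have "w \<notin> circle"
  proof
    assume "w \<in> circle"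
    then have "w \<in> chord_ends (closed_segment (circ x) (circ y))" using w(1) by (simp add: chord_ends_def)
    then have "w = circ x \<or> w = circ y" by (simp add: chord_ends_closed_segment)
    then show False using w(2) central_strip_pos_le[of x] central_strip_pos_le[of y] x y by auto
  qed
  then have w_ball: "w \<in> ball 0 1" using w(1) D_cball by fastforce
  define \<phi> where "\<phi> = leaf_side f"
  have \<phi>0: "\<phi> z = 0 \<longleftrightarrow> z \<in> f" if "norm z \<le> 1" for z
    unfolding \<phi>_def using leaf_side_eq_0_iff[OF f that] .
  have \<phi>_aff: "\<phi> ((1 - u) *\<^sub>R a + u *\<^sub>R b) = (1 - u) * \<phi> a + u * \<phi> b" for u a b
    by (simp add: \<phi>_def leaf_side_affine)
  have \<phi>xy: "\<phi> (circ x) \<noteq> 0" "\<phi> (circ y) \<noteq> 0"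
    using \<phi>0[of "circ x"] \<phi>0[of "circ y"] circ_in_leaf_imp_corner[OF f] x y h by force+
  \<comment> \<open>A neighbourhood of \<open>w\<close> that avoids all leaves except
    \<open>f\<close> and, unless \<open>w\<close> is on \<open>f\<close>, stays on its side of
    \<open>f\<close>.\<close>
  define U where "U = ball 0 1 \<inter> - \<Union>(F - {f}) \<inter> (if \<phi> w = 0 then UNIV else {z. 0 < \<phi> w * \<phi> z})"
  have "closed g" if "g \<in> F" for g using leaf[OF that] closed_segment by metis
  then have "closed (\<Union>(F - {f}))"
    using finite_F by (intro closed_Union) auto
  then have "open U"
    unfolding U_def \<phi>_def by (auto intro!: open_Int open_Collect_less continuous_intros)
  moreover have "w \<in> U"
    using w_ball only w(1) by (auto simp: U_def zero_less_mult_iff linorder_neq_iff)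
  ultimately obtain e where e: "0 < e" "ball w e \<subseteq> U" by (metis open_contains_ball)
  obtain v where v: "v \<in> \<Union> {R. C_region d F R \<and> 2 \<le> region_degree F R}" "v \<in> ball w e"
    using w(2) e(1) unfolding central_strip_def by (metis closure_approachable mem_ball dist_commute)
  then obtain R where R: "C_region d F R" "v \<in> R" by blast
  have comp: "R \<in> components (ball 0 1 - \<Union>F)" using R(1) by (simp add: C_region_def portrait_regions_def)
  have vB: "v \<in> ball 0 1 - \<Union>F" using in_components_subset[OF comp] R(2) by blast
  then have \<phi>v: "\<phi> v \<noteq> 0" using \<phi>0[of v] f by auto
  have vw: "0 \<le> \<phi> v * \<phi> w"
    using v(2) e(2) by (auto simp: U_def mult.commute split: if_splits)
  \<comment> \<open>\<open>\<phi>\<close> is affine along the chord, so if both ends were on the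
    side of \<open>f\<close> opposite to \<open>v\<close>, then so would be
    \<open>w\<close>.\<close>
  obtain c where c: "c = x \<or> c = y" "0 < \<phi> v * \<phi> (circ c)"
  proof (rule ccontr)
    assume "\<not> thesis"
    then have neg: "\<phi> v * \<phi> (circ x) < 0" "\<phi> v * \<phi> (circ y) < 0"
      using that \<phi>v \<phi>xy by (metis linorder_neqE_linordered_idom mult_eq_0_iff)+
    obtain u where u: "0 \<le> u" "u \<le> 1" "w = (1 - u) *\<^sub>R circ x + u *\<^sub>R circ y"
      using w(1) by (auto simp: in_segment)
    have "\<phi> v * \<phi> w = (1 - u) * (\<phi> v * \<phi> (circ x)) + u * (\<phi> v * \<phi> (circ y))"
      unfolding u(3) \<phi>_aff by (simp add: algebra_simps)
    also have "\<dots> < 0"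
      using u(1,2) neg
      by (cases "u = 0") (auto intro!: add_nonpos_neg mult_nonneg_nonpos[of "1 - u"] mult_pos_neg[of u])
    finally show False using vw by simp
  qed
  have w_neq: "w \<noteq> circ c" using w_ball by auto
  have seg: "open_segment w (circ c) \<subseteq> (ball 0 1 - \<Union>F) \<inter> {z. 0 < \<phi> v * \<phi> z}"
  proof
    fix z assume z: "z \<in> open_segment w (circ c)"
    then obtain u where u: "0 < u" "u < 1" "z = (1 - u) *\<^sub>R w + u *\<^sub>R circ c" by (auto simp: in_segment)
    have "\<phi> v * \<phi> z = (1 - u) * (\<phi> v * \<phi> w) + u * (\<phi> v * \<phi> (circ c))"
      unfolding u(3) \<phi>_aff by (simp add: algebra_simps)
    also have "\<dots> > 0"
      using u c(2) vw by (intro add_nonneg_pos mult_nonneg_nonneg[of "1 - u"] mult_pos_pos[of u]) auto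
    finally have pos: "0 < \<phi> v * \<phi> z" .
    have "closed_segment w (circ c) \<subseteq> closed_segment (circ x) (circ y)"
      using w(1) c(1) by (intro closed_segment_subset convex_closed_segment) auto
    then have zD: "z \<in> closed_segment (circ x) (circ y)" using z open_closed_segment by blast
    have "norm z < 1"
    proof -
      have "dist 0 z < dist 0 w \<or> dist 0 z < dist 0 (circ c)"
        by (rule dist_decreases_open_segment[OF z])
      then show ?thesis using w_ball by auto
    qed
    moreover have "z \<notin> f" using pos \<phi>0[of z] \<open>norm z < 1\<close> by auto
    ultimately show "z \<in> (ball 0 1 - \<Union>F) \<inter> {z. 0 < \<phi> v * \<phi> z}"
      using pos zD only by auto
  qed
  have "w \<in> closure (open_segment w (circ c))" using w_neq by (simp add: closure_open_segment)
  then obtain w' where w': "w' \<in> open_segment w (circ c)" "w' \<in> ball w e"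
    using e(1) by (metis closure_approachable mem_ball dist_commute)
  \<comment> \<open>The part of the ball on the side of \<open>v\<close> is convex and misses every
    leaf. It contains \<open>v\<close> and the point \<open>w'\<close> of the half chord, so both
    lie in \<open>R\<close>.\<close>
  have "connected (ball w e \<inter> {z. 0 < \<phi> v * \<phi> z})"
    unfolding \<phi>_def by (intro convex_connected convex_Int convex_ball convex_leaf_side)
  moreover have "ball w e \<inter> {z. 0 < \<phi> v * \<phi> z} \<subseteq> ball 0 1 - \<Union>F"
  proof
    fix z assume z: "z \<in> ball w e \<inter> {z. 0 < \<phi> v * \<phi> z}"
    then have "z \<in> U" using e(2) by blast
    then show "z \<in> ball 0 1 - \<Union>F" using z \<phi>0[of z] by (auto simp: U_def)
  qed
  moreover have "v \<in> ball w e \<inter> {z. 0 < \<phi> v * \<phi> z}"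
    using v(2) \<phi>v by (auto simp: zero_less_mult_iff linorder_neq_iff)
  ultimately have "ball w e \<inter> {z. 0 < \<phi> v * \<phi> z} \<subseteq> R"
    using R(2) by (intro components_maximal[OF comp]) auto
  then have "w' \<in> R" using w' seg by blast
  then have "open_segment w (circ c) \<subseteq> R"
    using w'(1) seg by (intro components_maximal[OF comp] convex_connected[OF convex_open_segment]) auto
  then have "closure (open_segment w (circ c)) \<subseteq> closure R" by (rule closure_mono)
  then have "circ c \<in> closure R" using w_neq by (auto simp: closure_open_segment)
  then show False using C_region_pos_le[OF R(1)] c(1) x y by force
qed

text \<open>The open chord lies in one region. If this region does not contribute to the strip, it
  is open and disjoint from those that do, hence from their closure. This treats a critical iterate,
  whose ends may still be on the strip.\<close>

lemma chord_inside_or_off_central_strip: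
  assumes seg: "open_segment a b \<subseteq> ball 0 1 - \<Union>F" and "a \<noteq> b"
  shows "closed_segment a b \<subseteq> central_strip d F \<or> open_segment a b \<inter> central_strip d F = {}"
proof -
  let ?\<C> = "{R. C_region d F R \<and> 2 \<le> region_degree F R}"
  have ne: "open_segment a b \<noteq> {}" using assms(2) by simp
  then obtain R where R: "R \<in> portrait_regions F" "open_segment a b \<subseteq> R"
    using exists_component_superset[OF seg _ convex_connected[OF convex_open_segment]] seg unfolding portrait_regions_def by blast
  show ?thesis
  proof (cases "R \<in> ?\<C>")
    case True
    then have "open_segment a b \<subseteq> \<Union>?\<C>" using R(2) by blast
    then have "closure (open_segment a b) \<subseteq> central_strip d F"
      unfolding central_strip_def by (rule closure_mono)
    then show ?thesis using assms(2) by (simp add: closure_open_segment)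
  next
    case False
    have "R \<inter> R' = {}" if "R' \<in> ?\<C>" for R'
      using that False R(1) components_nonoverlap[of R _ R'] by (auto simp: C_region_def portrait_regions_def)
    then have "R \<inter> \<Union>?\<C> = {}" by blast
    then have "R \<inter> central_strip d F = {}"
      unfolding central_strip_def using open_region[OF R(1)] open_Int_closure_eq_empty by blast
    then show ?thesis using R(2) by blast
  qed
qed

text \<open>The chord with endpoints \<open>x\<close> and \<open>x + r\<close> can cross a leaf only if this leaf ends at \<open>y\<close>,
  since there are no corners strictly between \<open>x + r\<close> and \<open>y\<close>.\<close>

lemma critical_chord_disjoint_central_strip:
  assumes y: "y = x + r + \<delta>" and r: "real d * r \<in> \<int>" and \<delta>: "real d * \<bar>\<delta>\<bar> < h"
    and px: "h < pos x" and py: "\<not> (0 < pos y \<and> pos y < h)"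
    and seg: "open_segment (circ x) (circ y) \<subseteq> ball 0 1 - \<Union>F"
  shows "closed_segment (circ x) (circ (x + r)) \<inter> central_strip d F = {}"
proof -
  have px': "pos (x + r) = pos x" using r by (rule pos_add)
  have no_corner: "pos t \<noteq> 0 \<and> pos t \<noteq> h" if t: "t \<in> closed_segment (x + r) y" "t \<noteq> y" for t
  proof (cases "0 \<le> \<delta>")
    case True
    then have t: "x + r \<le> t" "t < x + r + \<delta>" using that by (auto simp: y closed_segment_eq_real_ivl split: if_splits)
    then have "real d * (t - (x + r)) < real d * \<delta>" "0 \<le> real d * (t - (x + r))" using d2 by auto
    \<comment> \<open>Beyond 1 the position would start again from 0 and put \<open>y\<close> in the
      interior of a short arc.\<close>
    moreover have "pos x + real d * \<delta> \<le> 1"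
    proof (rule ccontr)
      assume "\<not> ?thesis"
      moreover have "real d * (\<delta> - 1 / real d) = real d * \<delta> - 1" using d2 by (simp add: field_simps)
      ultimately have "pos (x + r + (\<delta> - 1 / real d)) = pos x + real d * \<delta> - 1"
        using \<delta> True px' pos_bounds[of x] h by (subst pos_shift) auto
      moreover have "pos (x + r + (\<delta> - 1 / real d)) = pos y"
        using pos_add[of "- 1 / real d" y] d2 by (simp add: y algebra_simps)
      ultimately show False using py \<delta> True pos_bounds[of x] \<open>\<not> pos x + real d * \<delta> \<le> 1\<close> by auto
    qed
    ultimately have "pos (x + r + (t - (x + r))) = pos x + real d * (t - (x + r))"
      using px' pos_bounds[of x] by (subst pos_shift) auto
    then show ?thesis using px h \<open>0 \<le> real d * (t - (x + r))\<close> by auto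
  next
    case False
    then have t: "t \<le> x + r" "x + r + \<delta> < t" using that by (auto simp: y closed_segment_eq_real_ivl split: if_splits)
    then have dt: "real d * \<delta> < real d * (t - (x + r))" "real d * (t - (x + r)) \<le> 0" using d2 by (auto simp: mult_le_0_iff)
    have "\<bar>\<delta>\<bar> = - \<delta>" using False by simp
    then have "- (real d * \<delta>) < h" using \<delta> by simp
    moreover have "pos y = pos x + real d * \<delta>"
      unfolding y using px' calculation px pos_bounds[of x] dt by (subst pos_shift) auto
    \<comment> \<open>Moving back by less than \<open>h\<close> from a position above
      \<open>h\<close> leaves it positive, and \<open>py\<close> excludes positions between 0 and
      \<open>h\<close>.\<close>
    ultimately have "h \<le> pos x + real d * \<delta>" using py px by auto
    then have "pos (x + r + (t - (x + r))) = pos x + real d * (t - (x + r))"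
      using dt px' pos_bounds[of x] h by (subst pos_shift) auto
    then show ?thesis using dt h \<open>h \<le> pos x + real d * \<delta>\<close> by auto
  qed
  \<comment> \<open>Otherwise \<open>g\<close> strictly separates \<open>x\<close> from
    \<open>x + r\<close>, while \<open>y\<close> is on the side of \<open>x + r\<close>. Then
    \<open>g\<close> would meet the open chord from \<open>x\<close> to \<open>y\<close>, against
    \<open>seg\<close>.\<close>
  have y_in: "circ y \<in> g" if g: "g \<in> F" and z: "z \<in> closed_segment (circ x) (circ (x + r))" "z \<in> g" for g z
  proof (rule ccontr)
    assume "circ y \<notin> g"
    have g0: "leaf_side g (circ t) \<noteq> 0" if "circ t \<notin> g" for t
      using that leaf_side_eq_0_iff[OF g, of "circ t"] by simp
    have not_in: "circ x \<notin> g" "circ (x + r) \<notin> g"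
      using circ_in_leaf_imp_corner[OF g] px px' h by (metis less_irrefl less_trans)+
    obtain u where u: "0 \<le> u" "u \<le> 1" "z = (1 - u) *\<^sub>R circ x + u *\<^sub>R circ (x + r)"
      using z(1) by (auto simp: in_segment)
    have "norm z \<le> 1" using leaf_subset_cball[OF g] z(2) by auto
    then have "leaf_side g z = 0" using leaf_side_eq_0_iff[OF g] z(2) by blast
    then have 0: "(1 - u) * leaf_side g (circ x) + u * leaf_side g (circ (x + r)) = 0"
      unfolding u(3) leaf_side_affine .
    have "leaf_side g (circ x) * leaf_side g (circ (x + r)) < 0"
    proof (rule ccontr)
      assume "\<not> ?thesis"
      then have "0 < leaf_side g (circ x) * leaf_side g (circ (x + r))"
        using mult_eq_0_iff[of "leaf_side g (circ x)" "leaf_side g (circ (x + r))"] g0[OF not_in(1)] g0[OF not_in(2)]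
        by linarith
      then consider "0 < leaf_side g (circ x)" "0 < leaf_side g (circ (x + r))"
        | "leaf_side g (circ x) < 0" "leaf_side g (circ (x + r)) < 0" by (auto simp: zero_less_mult_iff)
      then show False
      proof cases
        case 1
        then have "0 < (1 - u) * leaf_side g (circ x) + u * leaf_side g (circ (x + r))"
          using u by (cases "u = 0") (auto intro!: add_nonneg_pos)
        then show False using 0 by simp
      next
        case 2
        then have "(1 - u) * leaf_side g (circ x) + u * leaf_side g (circ (x + r)) < 0"
          using u by (cases "u = 0") (auto intro!: add_nonpos_neg mult_nonneg_nonpos mult_pos_neg)
        then show False using 0 by simp
      qed
    qed
    moreover have "0 < leaf_side g (circ (x + r)) * leaf_side g (circ y)"
    proof (rule connected_nonzero_same_sign[of "closed_segment (x + r) y" "\<lambda>t. leaf_side g (circ t)"])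
      show "leaf_side g (circ t) \<noteq> 0" if "t \<in> closed_segment (x + r) y" for t
        using that no_corner[of t] \<open>circ y \<notin> g\<close> circ_in_leaf_imp_corner[OF g, of t] g0[of t] by (cases "t = y") auto
    qed (auto intro!: continuous_intros)
    ultimately have neg: "\<not> 0 < leaf_side g (circ x) * leaf_side g (circ y)"
      by (auto simp: zero_less_mult_iff mult_less_0_iff)
    obtain c where c: "c \<in> closed_segment (circ x) (circ y)" "leaf_side g c = 0"
      using connected_nonzero_same_sign[of "closed_segment (circ x) (circ y)" "leaf_side g" "circ x" "circ y"] neg
        continuous_on_leaf_side[OF continuous_on_id, of _ g] by (auto simp: id_def)
    have "c \<noteq> circ x" "c \<noteq> circ y" using c(2) g0 not_in \<open>circ y \<notin> g\<close> by auto
    then have "c \<in> ball 0 1 - \<Union>F" using c(1) seg by (auto simp: closed_segment_eq_open)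
    then show False using leaf_side_neq_0[OF g] c(2) by blast
  qed
  show ?thesis
  \<comment> \<open>By disjointness at most one leaf ends at \<open>circ y\<close>. If there is
    none, the critical chord misses all leaves and any leaf can serve as \<open>f\<close>.\<close>
  proof (cases "\<exists>f\<in>F. circ y \<in> f")
    case True
    then obtain f where f: "f \<in> F" "circ y \<in> f" by blast
    show ?thesis
      using y_in same_leaf[OF _ f(1) _ f(2)] px px' by (intro chord_disjoint_central_strip[OF _ _ f(1)]) auto
  next
    case False
    obtain f where "f \<in> F" using card_F d2 by fastforce
    then show ?thesis
      using y_in False px px' by (intro chord_disjoint_central_strip[of _ _ f]) auto
  qed
qed

end

text \<open>Of the two arcs cut off by the image leaf the shorter one is chosen, exchanging the ends
  if necessary. Its length is below \<open>1 / 2\<close> because diameters are excluded. The ends of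
  each leaf are then named by their images.\<close>

lemma sibling_collection_exists:
  assumes d: "d \<ge> 2" and L: "lamination L" and F: "full_sibling_collection d L F" "l \<in> F"
    and diam: "\<not> is_diameter (chord_image d l)"
  obtains p q \<alpha> h where "sibling_collection d F p q \<alpha> h"
proof -
  have "\<exists>l'\<in>L. \<not> degenerate l' \<and> (\<forall>f\<in>F. chord_image d f = l')"
    using F(1) by (simp add: full_sibling_collection_def)
  then obtain l' where l': "l' \<in> L" "\<not> degenerate l'" and im: "\<And>f. f \<in> F \<Longrightarrow> chord_image d f = l'"
    by metis
  obtain A B where AB: "A \<in> circle" "B \<in> circle" "l' = closed_segment A B"
    using L l'(1) unfolding lamination_def is_chord_def by metis
  obtain a where a: "A = circ a" using AB(1) circle_imp_circ by blast
  define k where "k = arc_len A B"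
  have B: "B = circ (a + k)" using circle_eq_circ_add[OF AB(2)] by (simp add: k_def a)
  obtain b where "B = circ b" using AB(2) circle_imp_circ by blast
  then have k: "0 \<le> k" "k < 1" by (simp_all add: k_def a arc_len_circ frac_lt_1)
  have "k \<noteq> 0" using l'(2) AB(3) a B by (auto simp: degenerate_def)
  have "k \<noteq> 1 / 2"
  proof
    assume "k = 1 / 2"
    then have "circ k = circ (1 / 2)" by (rule arg_cong)
    also have "\<dots> = - 1" by (simp add: circ_def)
    finally have "B = - A" by (simp add: B a circ_add)
    then have "is_diameter l'" unfolding is_diameter_def using AB by blast
    then show False using diam im[OF F(2)] by simp
  qed
  obtain \<beta> h where h: "0 < h" "h < 1 / 2" and l'_eq: "l' = closed_segment (circ \<beta>) (circ (\<beta> + h))"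
  proof (cases "k < 1 / 2")
    case True
    then show ?thesis using that[of k a] k \<open>k \<noteq> 0\<close> AB(3) a B by simp
  next
    case False
    have A: "circ (a + k + (1 - k)) = A" unfolding a by (simp add: circ_eq_iff)
    have "l' = closed_segment (circ (a + k)) (circ (a + k + (1 - k)))"
      unfolding A B[symmetric] AB(3) by (rule closed_segment_commute)
    then show ?thesis using that[of "1 - k" "a + k"] k False \<open>k \<noteq> 1 / 2\<close> by simp
  qed
  have "\<exists>x. fst x \<in> circle \<and> snd x \<in> circle \<and> f = closed_segment (fst x) (snd x) \<and>
      fst x ^ d = circ \<beta> \<and> snd x ^ d = circ (\<beta> + h)" if f: "f \<in> F" for f
  proof -
    have "F \<subseteq> L" using F(1) by (simp add: full_sibling_collection_def)
    then have "is_chord f" using f L unfolding lamination_def by (meson subsetD)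
    then obtain u v where uv: "u \<in> circle" "v \<in> circle" "f = closed_segment u v"
      unfolding is_chord_def by metis
    have "closed_segment (u ^ d) (v ^ d) = l'"
      using im[OF f] chord_image_closed_segment[OF uv(1,2)] uv(3) by (simp add: circle_map_def)
    then have "chord_ends (closed_segment (u ^ d) (v ^ d)) = chord_ends (closed_segment (circ \<beta>) (circ (\<beta> + h)))"
      by (simp only: l'_eq)
    then have "{u ^ d, v ^ d} = {circ \<beta>, circ (\<beta> + h)}"
      using uv by (simp add: chord_ends_closed_segment norm_power)
    then have "u ^ d = circ \<beta> \<and> v ^ d = circ (\<beta> + h) \<or> v ^ d = circ \<beta> \<and> u ^ d = circ (\<beta> + h)"
      by (auto simp: doubleton_eq_iff)
    then show ?thesis
    proof
      assume "u ^ d = circ \<beta> \<and> v ^ d = circ (\<beta> + h)"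
      then show ?thesis using uv by (intro exI[of _ "(u, v)"]) simp
    next
      assume "v ^ d = circ \<beta> \<and> u ^ d = circ (\<beta> + h)"
      then show ?thesis using uv closed_segment_commute[of u v] by (intro exI[of _ "(v, u)"]) simp
    qed
  qed
  then obtain e where e: "\<And>f. f \<in> F \<Longrightarrow> fst (e f) \<in> circle \<and> snd (e f) \<in> circle \<and>
      f = closed_segment (fst (e f)) (snd (e f)) \<and> fst (e f) ^ d = circ \<beta> \<and> snd (e f) ^ d = circ (\<beta> + h)"
    by metis
  have "sibling_collection d F (\<lambda>f. fst (e f)) (\<lambda>f. snd (e f)) (\<beta> / real d) h"
    by unfold_locales (use d h e F(1) in \<open>auto simp: full_sibling_collection_def\<close>)
  then show ?thesis by (rule that)
qed

section \<open>Critical chords sharing an end with a nearly critical leaf\<close>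

context sibling_collection
begin

lemma pos_diff: "real d * (y - x) - (pos y - pos x) \<in> \<int>"
proof -
  have "real d * (y - x) - (pos y - pos x) = of_int (\<lfloor>real d * (y - \<alpha>)\<rfloor> - \<lfloor>real d * (x - \<alpha>)\<rfloor>)"
    by (simp add: pos_def frac_def algebra_simps)
  then show ?thesis by (metis Ints_of_int)
qed

text \<open>The hypothesis on \<open>h\<close> says that the long arcs are longer than \<open>1 / (d + 1)\<close>.\<close>

lemma near_critical_not_in_short_arc:
  assumes h1: "h * (real d + 1) < 1"
    and y: "y = x + r + \<delta>" and r: "real d * r \<in> \<int>" "r \<notin> \<int>" and \<delta>: "real d * \<bar>\<delta>\<bar> \<le> h / real d"
    and seg: "open_segment (circ x) (circ y) \<subseteq> ball 0 1 - \<Union>F"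
    and strip: "\<not> closed_segment (circ x) (circ y) \<subseteq> central_strip d F"
  shows "\<not> (0 < pos x \<and> pos x < h)"
proof
  assume px: "0 < pos x \<and> pos x < h"
  have "circ y \<notin> circ ` {s..s + h / real d}" if s: "x \<in> {s..s + h / real d}" for s
  proof
    assume "circ y \<in> circ ` {s..s + h / real d}"
    then obtain u where u: "u \<in> {s..s + h / real d}" "circ y = circ u" by blast
    \<comment> \<open>If both ends were in one short arc, \<open>r\<close> would agree with
      \<open>e\<close> modulo 1. But \<open>real d * e\<close> is an integer of size at most
      \<open>h + h / d < 1\<close>, so \<open>e\<close> would be 0 and \<open>r\<close> an
      integer.\<close>
    define e where "e = u - x - \<delta>"
    have re: "r - e \<in> \<int>" using u(2) by (simp add: circ_eq_iff y e_def algebra_simps)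
    have "real d * r - real d * (r - e) \<in> \<int>" by (rule Ints_diff[OF r(1) Ints_mult[OF Ints_of_nat re]])
    then have de: "real d * e \<in> \<int>" by (simp add: algebra_simps)
    have "\<bar>u - x\<bar> \<le> h / real d" using u(1) s by (auto simp: abs_le_iff)
    then have "real d * \<bar>u - x\<bar> \<le> h" using d2 by (simp add: field_simps)
    moreover have "real d * \<bar>e\<bar> \<le> real d * \<bar>u - x\<bar> + real d * \<bar>\<delta>\<bar>"
      using d2 by (simp add: e_def distrib_left[symmetric])
    moreover have "h / real d \<le> h" using h d2 by (simp add: field_simps)
    moreover have "h * 2 < 1" using h by simp
    ultimately have "real d * \<bar>e\<bar> < 1" using \<delta> by linarith
    then have "\<bar>real d * e\<bar> < 1" by (simp add: abs_mult)
    then have "real d * e = 0" using Ints_abs_less_1[OF de] by linarith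
    then show False using re r(2) d2 by simp
  qed
  then show False using chord_subset_central_strip[OF seg] px strip by blast
qed

text \<open>The end in the long arc stays fixed, and the other one moves by \<open>\<delta>\<close>
  to \<open>x + r\<close>, which has the same image as \<open>x\<close>.\<close>

lemma critical_chord_from_long_arc:
  assumes y: "y = x + r + \<delta>" and r: "real d * r \<in> \<int>" "r \<notin> \<int>"
    and \<delta>: "\<delta> \<noteq> 0" "real d * \<bar>\<delta>\<bar> \<le> h / real d"
    and seg: "open_segment (circ x) (circ y) \<subseteq> ball 0 1 - \<Union>F"
    and px: "h < pos x" and py: "\<not> (0 < pos y \<and> pos y < h)"
  shows "\<exists>D. critical_chord d D \<and> D \<subseteq> cball 0 1 - central_strip d F
    \<and> has_endpoint_dist (closed_segment (circ x) (circ y)) D \<bar>\<delta>\<bar>"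
proof (intro exI conjI)
  have hd: "h / real d < h" using h d2 by (simp add: field_simps)
  have "circ x \<noteq> circ (x + r)" using r(2) by (simp add: circ_eq_iff)
  moreover have "circle_map d (circ x) = circle_map d (circ (x + r))"
    using r(1) by (simp add: circle_map_circ circ_eq_iff ring_distribs)
  ultimately show "critical_chord d (closed_segment (circ x) (circ (x + r)))"
    unfolding critical_chord_def using circ_mem by blast
  have "closed_segment (circ x) (circ (x + r)) \<inter> central_strip d F = {}"
    using \<delta>(2) hd by (intro critical_chord_disjoint_central_strip[OF y r(1) _ px py seg]) simp
  moreover have "closed_segment (circ x) (circ (x + r)) \<subseteq> cball 0 1"
    by (intro closed_segment_subset convex_cball) auto
  ultimately show "closed_segment (circ x) (circ (x + r)) \<subseteq> cball 0 1 - central_strip d F" by blast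
  have "real d * \<bar>\<delta>\<bar> < 1" using \<delta>(2) hd h by linarith
  then have "\<bar>\<delta>\<bar> < 1 / real d" using d2 by (simp add: field_simps)
  then show "has_endpoint_dist (closed_segment (circ x) (circ y)) (closed_segment (circ x) (circ (x + r))) \<bar>\<delta>\<bar>"
    unfolding y using d2 by (intro has_endpoint_dist_shared_end[OF _ r \<delta>(1)]) auto
qed

text \<open>The situation is symmetric under exchanging the ends and negating \<open>r\<close> and
  \<open>\<delta>\<close>, so one end in an open long arc is enough.\<close>

lemma critical_chord_near:
  assumes h1: "h * (real d + 1) < 1"
    and y: "y = x + r + \<delta>" and r: "real d * r \<in> \<int>" "r \<notin> \<int>"
    and \<delta>: "\<delta> \<noteq> 0" "real d * \<bar>\<delta>\<bar> \<le> h / real d"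
    and seg: "open_segment (circ x) (circ y) \<subseteq> ball 0 1 - \<Union>F"
    and strip: "\<not> closed_segment (circ x) (circ y) \<subseteq> central_strip d F"
  shows "\<exists>D. critical_chord d D \<and> D \<subseteq> cball 0 1 - central_strip d F
    \<and> has_endpoint_dist (closed_segment (circ x) (circ y)) D \<bar>\<delta>\<bar>"
proof -
  have x: "x = y + (- r) + (- \<delta>)" using y by simp
  have r': "real d * (- r) \<in> \<int>" "- r \<notin> \<int>" using r by auto
  have \<delta>': "- \<delta> \<noteq> 0" "real d * \<bar>- \<delta>\<bar> \<le> h / real d" using \<delta> by auto
  have seg': "open_segment (circ y) (circ x) \<subseteq> ball 0 1 - \<Union>F"
    using seg by (simp add: open_segment_commute)
  have strip': "\<not> closed_segment (circ y) (circ x) \<subseteq> central_strip d F"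
    using strip by (simp add: closed_segment_commute)
  have px: "\<not> (0 < pos x \<and> pos x < h)"
    using near_critical_not_in_short_arc[OF h1 y r \<delta>(2) seg strip] .
  have py: "\<not> (0 < pos y \<and> pos y < h)"
    using near_critical_not_in_short_arc[OF h1 x r' \<delta>'(2) seg' strip'] .
  have hd: "h / real d < h" using h d2 by (simp add: field_simps)
  \<comment> \<open>With both ends at corners, \<open>real d * \<delta>\<close> would be congruent
    to 0, \<open>h\<close> or \<open>- h\<close> modulo 1. Being smaller than \<open>h\<close> in
    size, it would vanish.\<close>
  have "h < pos x \<or> h < pos y"
  proof (rule ccontr)
    assume "\<not> ?thesis"
    then have corner: "pos x = 0 \<or> pos x = h" "pos y = 0 \<or> pos y = h"
      using px py pos_bounds[of x] pos_bounds[of y] by linarith+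
    have "real d * (y - x) - (pos y - pos x) - real d * r \<in> \<int>"
      by (rule Ints_diff[OF pos_diff r(1)])
    then have int: "real d * \<delta> - (pos y - pos x) \<in> \<int>" by (simp add: y algebra_simps)
    have "\<bar>real d * \<delta>\<bar> < h" using \<delta>(2) hd by (simp add: abs_mult)
    then have "real d * \<delta> - (pos y - pos x) = 0"
      using corner h by (intro Ints_abs_less_1[OF int]) auto
    then have "real d * \<delta> = 0" using corner \<open>\<bar>real d * \<delta>\<bar> < h\<close> h by auto
    then show False using \<delta>(1) d2 by simp
  qed
  then show ?thesis
  proof
    assume "h < pos x"
    then show ?thesis using critical_chord_from_long_arc[OF y r \<delta> seg _ py] by simp
  next
    assume "h < pos y"
    then show ?thesis
      using critical_chord_from_long_arc[OF x r' \<delta>' seg' _ px] by (simp add: closed_segment_commute)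
  qed
qed

lemma leaf_pos:
  assumes "closed_segment (circ x) (circ y) \<in> F"
  shows "pos x = 0 \<and> pos y = h \<or> pos x = h \<and> pos y = 0"
proof -
  let ?m = "closed_segment (circ x) (circ y)"
  have "{circ x, circ y} = {p ?m, q ?m}"
    using chord_ends_leaf[OF assms] by (simp add: chord_ends_closed_segment)
  then have "circ x = p ?m \<and> circ y = q ?m \<or> circ x = q ?m \<and> circ y = p ?m"
    by (auto simp: doubleton_eq_iff)
  moreover have "circ t = p ?m \<Longrightarrow> pos t = 0" "circ t = q ?m \<Longrightarrow> pos t = h" for t
    using p_power[OF assms] q_power[OF assms] circ_power_eq_iff[of 0 t] circ_power_eq_iff[of h t] h by auto
  ultimately show ?thesis by blast
qed

end

section \<open>The orbit of the leaf and the three claims\<close>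

lemma chord_iterate:
  "(chord_image d ^^ i) (closed_segment (circ s) (circ t)) = closed_segment (circ (real d ^ i * s)) (circ (real d ^ i * t))"
proof (induction i)
  case (Suc i)
  then show ?case
    by (simp add: chord_image_closed_segment circle_map_circ mult.assoc)
qed simp

text \<open>The closure in the degenerate case is there for the iterate that is itself critical: it
  may end at a corner of \<open>C\<close>.\<close>

theorem theorem2p9:
  fixes d :: nat and L F :: "complex set set" and l C :: "complex set" and \<eta> :: real
    and iter :: "nat \<Rightarrow> complex set"
  assumes "d \<ge> 2"
    and "sibling_invariant_lamination d L"
    and "full_sibling_collection d L F" and "l \<in> F"
    and "\<not> is_diameter (chord_image d l)"
    and "C = central_strip d F"
    and "long_arc_length d F > 1 / (real d + 1)"
    and "\<eta> = short_arc_length d F"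
    and "iter = (\<lambda>j. (chord_image d ^^ j) l)"
  shows "\<not> reenters C (iter 1) \<and>
    \<not> (reenters C (iter 2) \<and> ends_in_one_component C (iter 2)) \<and>
    (\<forall>j>1. reenters C (iter j) \<and> (\<forall>i. 1 < i \<and> i < j \<longrightarrow> \<not> reenters C (iter i)) \<and>
        ends_in_one_component C (iter j) \<longrightarrow>
      (\<exists>k D r. 1 \<le> k \<and> k \<le> j - 1 \<and> critical_chord d D \<and>
        (if degenerate (iter j) then D \<subseteq> closure (cball 0 1 - C) else D \<subseteq> cball 0 1 - C) \<and>
        has_endpoint_dist (iter k) D r \<and> r \<le> \<eta> / real d ^ (j - k)))"
proof -
  have L: "lamination L" and L_inv: "\<And>m. m \<in> L \<Longrightarrow> chord_image d m \<in> L"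
    using assms(2) by (simp_all add: sibling_invariant_lamination_def)
  have L_meet: "\<And>m m'. m \<in> L \<Longrightarrow> m' \<in> L \<Longrightarrow> m \<noteq> m' \<Longrightarrow> m \<inter> m' = {} \<or> (\<exists>w\<in>circle. m \<inter> m' = {w})"
    using L by (simp add: lamination_def)
  have FL: "F \<subseteq> L" using assms(3) by (simp add: full_sibling_collection_def)
  obtain p q \<alpha> h where "sibling_collection d F p q \<alpha> h"
    using sibling_collection_exists[OF assms(1) L assms(3,4,5)] .
  then interpret sibling_collection d F p q \<alpha> h .
  have \<eta>: "\<eta> = h / real d" using assms(8) by (simp add: short_arc_length_eq)
  have h1: "h * (real d + 1) < 1"
    using assms(7) d_pos unfolding long_arc_length_eq by (simp add: field_simps)
  have h1': "h + real d * h < 1" using h1 by (simp add: algebra_simps)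
  have dh: "2 * h \<le> real d * h" using d2 h by simp
  have hd: "h / real d \<le> h / 2" "0 < h / real d" using d2 h by (auto simp: field_simps)
  obtain s where s: "p l = circ s" using p_circle[OF assms(4)] circle_imp_circ by blast
  obtain t where t: "q l = circ t" using q_circle[OF assms(4)] circle_imp_circ by blast
  have iter: "iter i = closed_segment (circ (real d ^ i * s)) (circ (real d ^ i * t))" for i
    using leaf[OF assms(4)] chord_iterate[of i d s t] by (simp add: assms(9) s t)
  have iter_L: "iter i \<in> L" for i
    unfolding assms(9) by (induction i) (use assms(4) FL L_inv in auto)
  have ends_iter: "chord_ends (iter i) = {circ (real d ^ i * s), circ (real d ^ i * t)}" for i
    unfolding iter by (simp add: chord_ends_closed_segment)
  have diff1: "real d * (t - s) - h \<in> \<int>"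
  proof -
    have "pos s = 0" "pos t = h"
      using p_power[OF assms(4)] q_power[OF assms(4)] circ_power_eq_iff[of 0 s] circ_power_eq_iff[of h t] h
      by (auto simp: s t)
    then show ?thesis using pos_diff[of t s] by simp
  qed
  have part1: "\<not> reenters C (iter 1)"
  proof
    assume "reenters C (iter 1)"
    then have "circ (real d * s) \<in> C" "circ (real d * t) \<in> C"
      by (auto simp: reenters_def iter)
    then have le: "pos (real d * s) \<le> h" "pos (real d * t) \<le> h"
      using central_strip_pos_le assms(6) by blast+
    have "circ (real d * t) = circ (real d * s + h)"
      using diff1 by (simp add: circ_eq_iff algebra_simps)
    \<comment> \<open>The ends of the first image differ by \<open>h\<close>, which changes
      \<open>pos\<close> by \<open>real d * h\<close>, at least \<open>2 * h\<close>. The bound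
      \<open>h + real d * h < 1\<close> rules out wrapping around.\<close>
    then have "pos (real d * t) = pos (real d * s + h)" by (rule pos_cong)
    also have "\<dots> = pos (real d * s) + real d * h"
      using le(1) h1 pos_bounds[of "real d * s"] dh h by (intro pos_shift) (auto simp: algebra_simps)
    finally show False using le(2) pos_bounds[of "real d * s"] dh h by linarith
  qed
  have close: "\<exists>r. \<bar>r\<bar> \<le> \<eta> \<and> real d ^ j * (t - s) - r \<in> \<int>" if one: "ends_in_one_component C (iter j)" for j
  proof -
    obtain K where K: "K \<in> components (central_strip d F \<inter> circle)" "chord_ends (iter j) \<subseteq> K"
      using one unfolding ends_in_one_component_def assms(6) by blast
    then have "circ (real d ^ j * s) \<in> K" "circ (real d ^ j * t) \<in> K" by (auto simp: ends_iter)
    then obtain r where "\<bar>r\<bar> \<le> h / real d" "real d ^ j * t - real d ^ j * s - r \<in> \<int>"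
      using component_ends_close[OF K(1)] by blast
    then show ?thesis unfolding \<eta> by (intro exI[of _ r]) (simp add: algebra_simps)
  qed
  have part2: "\<not> (reenters C (iter 2) \<and> ends_in_one_component C (iter 2))"
  proof
    assume "reenters C (iter 2) \<and> ends_in_one_component C (iter 2)"
    then obtain r where r: "\<bar>r\<bar> \<le> h / real d" "real d ^ 2 * (t - s) - r \<in> \<int>"
      using close \<eta> by blast
    \<comment> \<open>The end difference of the second image is \<open>real d * h\<close> modulo 1,
      too large for one short arc and too small to come round to it again.\<close>
    have "(real d ^ 2 * (t - s) - r) - real d * (real d * (t - s) - h) \<in> \<int>"
      by (rule Ints_diff[OF r(2) Ints_mult[OF Ints_of_nat diff1]])
    then have "real d * h - r \<in> \<int>" by (simp add: algebra_simps power2_eq_square)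
    moreover have "0 < real d * h - r" using r(1) dh hd h by linarith
    moreover have "real d * h - r < 1" using r(1) h1' hd h by linarith
    ultimately show False by (rule Ints_not_between)
  qed
  have part3: "\<exists>k D r. 1 \<le> k \<and> k \<le> j - 1 \<and> critical_chord d D \<and>
        (if degenerate (iter j) then D \<subseteq> closure (cball 0 1 - C) else D \<subseteq> cball 0 1 - C) \<and>
        has_endpoint_dist (iter k) D r \<and> r \<le> \<eta> / real d ^ (j - k)"
    if j: "1 < j" and least: "\<And>i. 1 < i \<Longrightarrow> i < j \<Longrightarrow> \<not> reenters C (iter i)"
      and one: "ends_in_one_component C (iter j)" for j
  proof -
    \<comment> \<open>The tolerance is divided by \<open>d\<close> for each step back from
      \<open>j\<close>. It admits stage \<open>j\<close>, whose ends share a component, but not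
      stage 1, whose difference is \<open>h\<close> modulo 1.\<close>
    define near where "near k \<longleftrightarrow> (\<exists>r. \<bar>r\<bar> \<le> \<eta> / real d ^ (j - k) \<and> real d ^ k * (t - s) - r \<in> \<int>)" for k
    have "near j" using close[OF one] by (simp add: near_def)
    moreover have "\<not> near 1"
    proof
      assume "near 1"
      then obtain r where r: "\<bar>r\<bar> \<le> \<eta> / real d ^ (j - 1)" "real d * (t - s) - r \<in> \<int>" by (auto simp: near_def)
      have "\<eta> / real d ^ (j - 1) \<le> \<eta> / 1" using d2 hd \<eta> by (intro divide_left_mono) auto
      then have "\<bar>r\<bar> \<le> h / 2" using r(1) hd \<eta> by linarith
      moreover have "(real d * (t - s) - r) - (real d * (t - s) - h) \<in> \<int>" by (rule Ints_diff[OF r(2) diff1])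
      then have "h - r \<in> \<int>" by simp
      ultimately show False using Ints_not_between[of "h - r"] h by linarith
    qed
    \<comment> \<open>The last stage before a passage from failure to success; without one, failure
      would propagate from 1 to \<open>j\<close>.\<close>
    ultimately obtain k where k: "1 \<le> k" "k < j" "\<not> near k" "near (Suc k)"
      using dec_induct[of 1 j "\<lambda>k. \<not> near k"] j by auto
    define x y where "x = real d ^ k * s" and "y = real d ^ k * t"
    obtain r' where r': "\<bar>r'\<bar> \<le> \<eta> / real d ^ (j - Suc k)" "real d ^ Suc k * (t - s) - r' \<in> \<int>"
      using k(4) near_def by blast
    \<comment> \<open>Dividing the relation at stage \<open>k + 1\<close> by \<open>d\<close> splits
      the end difference of \<open>iter k\<close> into a multiple \<open>r\<close> of
      \<open>1 / d\<close> and an error \<open>\<delta>\<close>. Failure of \<open>near k\<close>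
      makes \<open>r\<close> non-integral.\<close>
    define \<delta> r where "\<delta> = r' / real d" and "r = y - x - \<delta>"
    have y: "y = x + r + \<delta>" by (simp add: r_def)
    have "real d * r = real d ^ Suc k * (t - s) - r'"
      using d2 by (simp add: r_def x_def y_def \<delta>_def algebra_simps)
    then have dr: "real d * r \<in> \<int>" using r'(2) by simp
    have "j - k = Suc (j - Suc k)" using k(2) by simp
    then have \<delta>: "\<bar>\<delta>\<bar> \<le> \<eta> / real d ^ (j - k)"
      using r'(1) d2 by (simp add: \<delta>_def abs_divide field_simps)
    have r: "r \<notin> \<int>"
    proof
      assume "r \<in> \<int>"
      then have "real d ^ k * (t - s) - \<delta> \<in> \<int>" by (simp add: r_def x_def y_def algebra_simps)
      then show False using \<delta> k(3) near_def by blast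
    qed
    have d\<delta>: "real d * \<bar>\<delta>\<bar> \<le> h / real d"
    proof -
      have "\<eta> / real d ^ (j - k) \<le> \<eta> / real d ^ 1"
        using d2 hd \<eta> k(2) by (intro divide_left_mono power_increasing) auto
      then have "\<bar>\<delta>\<bar> \<le> h / real d / real d" using \<delta> \<eta> by simp
      then show ?thesis using d2 by (simp add: field_simps)
    qed
    have iter_k: "iter k = closed_segment (circ x) (circ y)" by (simp add: iter x_def y_def)
    have int_d\<delta>: "real d * (y - x) - real d * \<delta> \<in> \<int>" using dr by (simp add: y algebra_simps)
    have abs_d\<delta>: "\<bar>real d * \<delta>\<bar> \<le> h / 2" using d\<delta> hd(1) abs_mult[of "real d" \<delta>] by linarith
    have neq: "circ x \<noteq> circ y"
    proof
      assume "circ x = circ y"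
      then have xy: "y - x \<in> \<int>" by (metis circ_eq_iff)
      have "real d * (y - x) - (real d * (y - x) - real d * \<delta>) \<in> \<int>"
        by (rule Ints_diff[OF Ints_mult[OF Ints_of_nat xy] int_d\<delta>])
      then have "real d * \<delta> = 0" using abs_d\<delta> h by (intro Ints_abs_less_1) auto
      then show False using r xy d2 by (simp add: y)
    qed
    \<comment> \<open>The ends of a sibling have positions differing by \<open>h\<close>, whereas
      here the difference is \<open>real d * \<delta>\<close> modulo 1, of size at most
      \<open>h / 2\<close>.\<close>
    have not_F: "iter k \<notin> F"
    proof
      assume "iter k \<in> F"
      then have "pos x = 0 \<and> pos y = h \<or> pos x = h \<and> pos y = 0" using leaf_pos iter_k by simp
      moreover have "(real d * (y - x) - (pos y - pos x)) - (real d * (y - x) - real d * \<delta>) \<in> \<int>"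
        by (rule Ints_diff[OF pos_diff int_d\<delta>])
      then have "real d * \<delta> - (pos y - pos x) \<in> \<int>" by (simp add: algebra_simps)
      ultimately show False
        using Ints_abs_less_1[of "real d * \<delta> - (pos y - pos x)"] abs_d\<delta> h by linarith
    qed
    have seg: "open_segment (circ x) (circ y) \<subseteq> ball 0 1 - \<Union>F"
    proof
      fix z assume z: "z \<in> open_segment (circ x) (circ y)"
      have nz: "norm z < 1" using dist_decreases_open_segment[OF z, of 0] by auto
      have "z \<notin> f" if f: "f \<in> F" for f
      proof
        assume "z \<in> f"
        moreover have "z \<in> iter k" using z iter_k open_closed_segment by blast
        moreover have "iter k \<inter> f = {} \<or> (\<exists>w\<in>circle. iter k \<inter> f = {w})"
          using L_meet[OF iter_L[of k], of f] FL f not_F by (metis subsetD)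
        ultimately have "z \<in> circle" by (metis IntI empty_iff singletonD)
        then show False using nz by simp
      qed
      then show "z \<in> ball 0 1 - \<Union>F" using nz by auto
    qed
    \<comment> \<open>Minimality of \<open>j\<close> concerns only stages above 1; stage 1 is
      covered by the first claim.\<close>
    have "\<not> reenters C (iter k)"
      using part1 least[of k] k(1,2) by (cases "k = 1") auto
    then have strip: "\<not> closed_segment (circ x) (circ y) \<subseteq> central_strip d F"
      by (simp add: reenters_def iter_k assms(6))
    have "\<exists>D r. critical_chord d D \<and>
        (if degenerate (iter j) then D \<subseteq> closure (cball 0 1 - C) else D \<subseteq> cball 0 1 - C) \<and>
        has_endpoint_dist (iter k) D r \<and> r \<le> \<eta> / real d ^ (j - k)"
    proof (cases "\<delta> = 0")
      case True
      have "circle_map d (circ x) = circle_map d (circ y)"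
        using dr by (simp add: circle_map_circ circ_eq_iff y True algebra_simps)
      then have crit: "critical_chord d (iter k)"
        unfolding critical_chord_def iter_k using neq circ_mem by blast
      have "is_chord (iter k)" unfolding is_chord_def iter_k using circ_mem by blast
      then have dist: "has_endpoint_dist (iter k) (iter k) 0" by (simp add: has_endpoint_dist_def)
      \<comment> \<open>With no error the end difference is an integer from stage
        \<open>k + 1\<close> on, so \<open>iter j\<close> is a point and the closure is
        permitted.\<close>
      have "real d ^ j * (t - s) = real d ^ (j - Suc k) * (real d ^ Suc k * (t - s))"
        using k(2) by (simp add: mult.assoc[symmetric] power_add[symmetric] del: power_Suc)
      also have "\<dots> \<in> \<int>"
      proof (rule Ints_mult)
        have "r' = 0" using True d2 by (simp add: \<delta>_def)
        then show "real d ^ Suc k * (t - s) \<in> \<int>" using r'(2) by (simp only: diff_zero)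
      qed (intro Ints_power Ints_of_nat)
      finally have "circ (real d ^ j * t) = circ (real d ^ j * s)"
        by (simp add: circ_eq_iff algebra_simps)
      then have deg: "degenerate (iter j)" unfolding degenerate_def iter by simp
      have "open_segment (circ x) (circ y) \<subseteq> cball 0 1 - C"
        using chord_inside_or_off_central_strip[OF seg neq] strip seg assms(6) by fastforce
      then have "closure (open_segment (circ x) (circ y)) \<subseteq> closure (cball 0 1 - C)" by (rule closure_mono)
      then have "iter k \<subseteq> closure (cball 0 1 - C)" using neq by (simp add: closure_open_segment iter_k)
      then show ?thesis
        using crit dist deg \<delta> True by (intro exI[of _ "iter k"] exI[of _ 0]) simp
    next
      case False
      obtain D where D: "critical_chord d D" "D \<subseteq> cball 0 1 - C" "has_endpoint_dist (iter k) D \<bar>\<delta>\<bar>"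
        using critical_chord_near[OF h1 y dr r False d\<delta> seg strip] unfolding iter_k assms(6) by blast
      then have "if degenerate (iter j) then D \<subseteq> closure (cball 0 1 - C) else D \<subseteq> cball 0 1 - C"
        using closure_subset by auto
      then show ?thesis using D \<delta> by blast
    qed
    moreover have "k \<le> j - 1" using k(2) by simp
    ultimately show ?thesis using k(1) by blast
  qed
  show ?thesis using part1 part2 part3 by blast
qed

end
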